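(* We have \[ \sum_{n\ge0}\ \sum_{\pi\in \mathfrak D^2_{2n}(3142)} q^{\mathrm{fix}(\pi)} x^n=\frac{1+x(q-1)-\sqrt{1-2x(q+1)+x^2(q-1)^2}}{2xq}, \] where $\mathrm{fix}(\pi)$ is the number of fixed points of $\pi$. That is, for $n\ge 1$ and $k\ge 0$, the number of permutations $\pi\in\mathfrak D^2_{2n}(3142)$ with exactly $k$ fixed points is the Narayana number $N(n,k)=\frac{1}{n}\binom{n}{k}\binom{n}{k+1}$, which is also the number of noncrossing partitions of $\{1,\dots,n\}$ into $n-k$ parts.
   Context: A permutation $\sigma\in\mathfrak S_N$ contains a pattern $\tau\in\mathfrak S_k$ if there are positions $i_1<\dots<i_k$ such that $(\sigma(i_1),\dots,\sigma(i_k))$ is order-isomorphic to $\tau$; otherwise $\sigma$ avoids $\tau$. A Dumont permutation of the second kind is a permutation $\pi\in\mathfrak S_{2n}$ such that $\pi(2i)<2i$ and $\pi(2i-1)\ge 2i-1$ for every $i=1,\dots,n$. $\mathfrak D^2_{2n}$ is the set of these (for $n=0$, just the empty permutation), and $\mathfrak D^2_{2n}(3142)$ is the subset of those avoiding $3142$. A set partition of $\{1,\dots,n\}$ is noncrossing if there are no $a<b<c<d$ with $a,c$ in one block and $b,d$ in a different block. The generating function identity is one of formal power series in $x$; the square root has constant term $1$. *)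

theory Defs
  imports
    "HOL-Combinatorics.Permutations"
    "HOL-Library.Disjoint_Sets"
    "HOL-Computational_Algebra.Computational_Algebra"
begin

(* Permutations of {1..N} are functions that satisfy the library predicate "permutes" (identity
   outside {1..N}).  A pattern is given in one-line notation; its positions are 0, ..., k-1. *)
definition contains_pattern :: "nat \<Rightarrow> (nat \<Rightarrow> nat) \<Rightarrow> nat list \<Rightarrow> bool" where
  "contains_pattern N \<sigma> \<tau> \<longleftrightarrow>
     (\<exists>p. strict_mono_on {..<length \<tau>} p \<and> p ` {..<length \<tau>} \<subseteq> {1..N} \<and>
          (\<forall>a<length \<tau>. \<forall>b<length \<tau>. \<sigma> (p a) < \<sigma> (p b) \<longleftrightarrow> \<tau> ! a < \<tau> ! b))"

definition avoids_pattern :: "nat \<Rightarrow> (nat \<Rightarrow> nat) \<Rightarrow> nat list \<Rightarrow> bool" where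
  "avoids_pattern N \<sigma> \<tau> \<longleftrightarrow> \<not> contains_pattern N \<sigma> \<tau>"

definition dumont2 :: "nat \<Rightarrow> (nat \<Rightarrow> nat) set" where
  "dumont2 n =
     {\<pi>. \<pi> permutes {1..2*n} \<and> (\<forall>i\<in>{1..n}. \<pi> (2*i) < 2*i \<and> \<pi> (2*i - 1) \<ge> 2*i - 1)}"

definition dumont2_avoiding :: "nat \<Rightarrow> nat list \<Rightarrow> (nat \<Rightarrow> nat) set" where
  "dumont2_avoiding n \<tau> = {\<pi> \<in> dumont2 n. avoids_pattern (2*n) \<pi> \<tau>}"

definition num_fixed_points :: "nat \<Rightarrow> (nat \<Rightarrow> nat) \<Rightarrow> nat" where
  "num_fixed_points N \<pi> = card {i\<in>{1..N}. \<pi> i = i}"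

definition noncrossing :: "nat set set \<Rightarrow> bool" where
  "noncrossing P \<longleftrightarrow>
     \<not> (\<exists>a b c d. \<exists>B\<in>P. \<exists>C\<in>P. a < b \<and> b < c \<and> c < d \<and> B \<noteq> C \<and>
          a \<in> B \<and> c \<in> B \<and> b \<in> C \<and> d \<in> C)"

definition noncrossing_partitions :: "nat \<Rightarrow> nat set set set" where
  "noncrossing_partitions n = {P. partition_on {1..n} P \<and> noncrossing P}"

definition narayana :: "nat \<Rightarrow> nat \<Rightarrow> rat" where
  "narayana n k = 1 / of_nat n * of_nat (n choose k) * of_nat (n choose (k + 1))"

(* The indeterminate q, as an element of the coefficient field Q(q) of the power series in x.
   A field is needed because the closed form divides by 2xq. *)
definition q_var :: "rat poly fract" where
  "q_var = to_fract [:0, 1:]"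

(* The square root with constant term 1; meaningful only for series with constant term 1. *)
definition fps_sqrt :: "'a :: field_char_0 fps \<Rightarrow> 'a fps" where
  "fps_sqrt f = fps_radical (\<lambda>_ _. 1) 2 f"

lemma fps_sqrt_unique:
  assumes "f $ 0 = 1"
  shows "s ^ 2 = f \<and> s $ 0 = 1 \<longleftrightarrow> s = fps_sqrt f"
proof -
  have f0: "f $ 0 \<noteq> 0" using assms by simp
  have sq: "fps_sqrt f ^ 2 = f" and c: "fps_sqrt f $ 0 = 1"
    using power_radical[of f "\<lambda>_ _. 1" 1, OF f0] assms
    by (simp_all add: fps_sqrt_def numeral_2_eq_2)
  have "s = fps_sqrt f" if "s ^ 2 = f" "s $ 0 = 1"
    using radical_unique[of "\<lambda>_ _. 1" 1 f s] assms that
    by (simp add: fps_sqrt_def numeral_2_eq_2)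
  then show ?thesis using sq c by blast
qed

end

theory Submission
  imports Defs
begin

text \<open>
  If \<open>\<pi>\<close> is a nonempty Dumont permutation of the second kind that avoids 3142, then \<open>\<pi> 2 = 1\<close>, and
  avoidance forces \<open>\<pi> = (2k + 2, 1, rc(\<sigma>) + 1) \<oplus> \<tau>\<close>, where \<open>\<sigma>\<close>, \<open>\<tau>\<close> are again of this
  kind and \<open>rc\<close> is the reverse complement. A fixed point inside the first block comes from a drop
  \<open>\<sigma> i = i - 1\<close>, and a drop from a fixed point of \<open>\<sigma>\<close>. So the generating functions \<open>F\<close> of fixed
  points and \<open>H\<close> of drops satisfy \<open>F = 1 + xHF\<close> and \<open>H = 1 + qxFH\<close>, whence \<open>H = 1 + q(F - 1)\<close> and
  \<open>F = 1 + xF(1 + q(F - 1))\<close>. This quadratic equation gives the closed form, and with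
  \<open>Y = F - 1 = x(1 + Y)(1 + qY)\<close> Lagrange inversion gives the Narayana numbers. Splitting a
  noncrossing partition of \<open>{1..n + 1}\<close> at the predecessor of \<open>n + 1\<close> in its block yields the same
  equation.
\<close>

section \<open>The Narayana functional equation\<close>

text \<open>Turns a recurrence of convolution type, as produced by a decomposition into two parts,
  into an equation of power series.\<close>

lemma fps_eq_if_convolution:
  fixes f g h :: "nat \<Rightarrow> 'a::comm_ring_1"
  assumes "\<And>n. f (Suc n) = (\<Sum>k\<le>n. g k * h (n - k))"
  shows "Abs_fps f = fps_const (f 0) + fps_X * (Abs_fps g * Abs_fps h)"
proof (rule fps_ext)
  have "(Abs_fps g * Abs_fps h) $ m = (\<Sum>k\<le>m. g k * h (m - k))" for m
    by (simp add: fps_mult_nth atLeast0AtMost)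
  then show "Abs_fps f $ n = (fps_const (f 0) + fps_X * (Abs_fps g * Abs_fps h)) $ n"
    for n by (cases n) (simp_all add: assms)
qed

section \<open>Residues of formal Laurent series and Lagrange inversion\<close>

text \<open>A negative power is a natural power of \<open>inverse f\<close>, so the power rule for
  natural exponents and the derivative of an inverse give the result.\<close>

lemma fls_deriv_power_int:
  fixes f :: "'a::field_char_0 fls"
  assumes "f \<noteq> 0"
  shows "fls_deriv (f powi m) = of_int m * f powi (m - 1) * fls_deriv f"
proof (cases "m \<ge> 0")
  case True
  then obtain n where m: "m = int n" using nonneg_int_cases by blast
  show ?thesis
  proof (cases n)
    case (Suc k)
    have "f powi (int (Suc k) - 1) = f ^ k" by simp
    then show ?thesis unfolding m by (simp add: fls_deriv_power Suc del: power_Suc of_nat_Suc)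
  qed (simp add: m)
next
  case False
  then obtain n where m: "m = - int n" and n: "n > 0"
    using that[of "nat (-m)"] by simp
  have "fls_deriv (f powi m) = fls_deriv (inverse f ^ n)"
    by (simp add: m power_int_minus power_inverse)
  also have "\<dots> = - (of_nat n * (inverse f ^ (n - 1) * inverse f ^ 2) * fls_deriv f)"
    by (simp add: fls_deriv_power fls_inverse_deriv mult_ac)
  also have "inverse f ^ (n - 1) * inverse f ^ 2 = inverse f ^ (n + 1)"
    using n by (simp add: power_add[symmetric])
  also have "inverse f ^ (n + 1) = f powi (m - 1)"
    using assms by (simp add: m power_int_minus power_int_diff power_inverse field_simps)
  finally show ?thesis by (simp add: m)
qed

text \<open>For \<open>m \<noteq> -1\<close> the product is a multiple of the derivative of
  \<open>f powi (m + 1)\<close>, and derivatives have residue 0. For \<open>m = -1\<close> it is the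
  logarithmic derivative, whose residue is the order of \<open>f\<close>.\<close>

lemma fls_residue_power_int_times_deriv:
  fixes f :: "'a::field_char_0 fls"
  assumes "f \<noteq> 0"
  shows "fls_residue (f powi m * fls_deriv f) = (if m = -1 then of_int (fls_subdegree f) else 0)"
proof (cases "m = -1")
  case True
  then show ?thesis
    using fls_residue_deriv_times_inverse_eq_subdegree(2)[of f] by (simp add: power_int_minus)
next
  case False
  then have "(of_int (m + 1) :: 'a) \<noteq> 0"
    by (metis add.inverse_unique add.commute of_int_eq_0_iff)
  moreover have "of_int (m + 1) * fls_residue (f powi m * fls_deriv f)
      = fls_residue (fls_deriv (f powi (m + 1)))"
    unfolding fls_residue_of_int_times(1)[symmetric] using fls_deriv_power_int[OF assms, of "m + 1"]
    by (simp add: mult.assoc)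
  ultimately show ?thesis using False fls_residue_deriv by (metis mult_eq_0_iff)
qed

lemma fps_to_fls_sum: "fps_to_fls (\<Sum>j\<in>A. f j) = (\<Sum>j\<in>A. fps_to_fls (f j))"
  by (induction A rule: infinite_finite_induct) auto

text \<open>The hypothesis expresses the \<open>n\<close>-th negative power of \<open>x\<close> as a
  combination of the powers \<open>y powi (e j - n)\<close>. After multiplication by the derivative
  of \<open>y\<close>, taking residues keeps only the exponent -1 on the right and leaves the
  coefficient of index \<open>n - 1\<close> of the derivative on the left. The sum stands for the
  expansion of the \<open>n\<close>-th power of the usual series \<open>\<phi>(Y)\<close>, so that
  no composition of series occurs.\<close>

lemma fps_lagrange_inversion:
  fixes Y :: "'a::field_char_0 fps"
  assumes Y: "Y $ 0 = 0" "Y $ 1 \<noteq> 0" and "finite A"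
    and eq: "Y ^ n = fps_X ^ n * (\<Sum>j\<in>A. fps_const (c j) * Y ^ e j)"
  shows "of_nat n * Y $ n = (\<Sum>j\<in>{j\<in>A. e j + 1 = n}. c j)"
proof (cases "n = 0")
  case False
  define y where "y = fps_to_fls Y"
  define x :: "'a fls" where "x = fls_X"
  have sub: "subdegree Y = 1" using Y by (intro subdegreeI) auto
  have y0: "y \<noteq> 0" using Y by (auto simp: y_def)
  have x0: "x \<noteq> 0" by (simp add: x_def)
  have "y ^ n = x ^ n * (\<Sum>j\<in>A. fls_const (c j) * y ^ e j)"
    using arg_cong[OF eq, of fps_to_fls] unfolding y_def x_def
    by (simp add: fls_times_fps_to_fls fps_to_fls_power fps_to_fls_sum)
  \<comment> \<open>Laurent series form a field, so the hypothesis can be solved for the negative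
    power of \<open>x\<close>.\<close>
  moreover have "inverse (x ^ n) = S * inverse (y ^ n)" if "y ^ n = x ^ n * S" for S
    using that x0 y0 by (cases "S = 0") (auto simp: field_simps)
  ultimately have "x powi (- int n) = (\<Sum>j\<in>A. fls_const (c j) * y ^ e j) * y powi (- int n)"
    by (simp add: power_int_minus)
  also have "\<dots> = (\<Sum>j\<in>A. fls_const (c j) * y powi (int (e j) - int n))"
    using y0 unfolding sum_distrib_right
    by (intro sum.cong) (simp_all add: power_int_diff power_int_minus divide_inverse mult.assoc)
  finally have "x powi (- int n) * fls_deriv y
      = (\<Sum>j\<in>A. fls_const (c j) * (y powi (int (e j) - int n) * fls_deriv y))"
    by (simp add: sum_distrib_right mult.assoc)
  then have "fls_residue (x powi (- int n) * fls_deriv y)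
      = (\<Sum>j\<in>A. c j * fls_residue (y powi (int (e j) - int n) * fls_deriv y))"
    by (simp add: fls_nth_sum fls_residue_fls_const_times(1)[unfolded fls_residue_def])
  \<comment> \<open>The surviving residue is the order of \<open>y\<close>, which is 1.\<close>
  also have "\<dots> = (\<Sum>j\<in>A. if e j + 1 = n then c j else 0)"
    unfolding fls_residue_power_int_times_deriv[OF y0]
    using sub by (intro sum.cong) (auto simp: y_def fls_subdegree_fls_to_fps)
  also have "\<dots> = (\<Sum>j\<in>{j\<in>A. e j + 1 = n}. c j)"
    using \<open>finite A\<close> by (simp add: sum.inter_filter)
  also have "fls_residue (x powi (- int n) * fls_deriv y) = fls_nth (fls_deriv y) (int n - 1)"
    unfolding fls_residue_shift_nth[of _ "int n - 1"] x_def
    by (simp add: fls_X_power_int)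
  also have "\<dots> = of_nat n * Y $ n" using False by (simp add: y_def)
  finally show ?thesis .
qed (use assms in auto)

text \<open>Lagrange inversion asks for the coefficient of \<open>Y ^ (n - 1)\<close> in the product
  of the \<open>n\<close>-th powers of \<open>1 + Y\<close> and \<open>1 + qY\<close>. Its part with
  \<open>q ^ b\<close> is \<open>(n choose (n - 1 - b)) * (n choose b)\<close>, and the symmetry of
  binomial coefficients makes the first factor \<open>n choose (b + 1)\<close>.\<close>

lemma narayana_equation_coeff:
  fixes F :: "'a::field_char_0 fps"
  assumes F: "F = 1 + fps_X * F * (1 + fps_const q * (F - 1))"
  shows "of_nat n * (F - 1) $ n = (\<Sum>k\<le>n. of_nat ((n choose k) * (n choose (k + 1))) * q ^ k)"
proof -
  define Y where "Y = F - 1"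
  have Y: "Y = fps_X * ((1 + Y) * (1 + fps_const q * Y))"
    using F by (simp add: Y_def algebra_simps)
  have Y0: "Y $ 0 = 0" by (subst Y) simp
  have Y1: "Y $ 1 = 1" by (subst Y) (simp add: Y0)
  define c where "c = (\<lambda>(a, b). of_nat (n choose a) * (of_nat (n choose b) * q ^ b))"
  have "Y ^ n = fps_X ^ n * ((1 + Y) ^ n * (1 + fps_const q * Y) ^ n)"
    by (subst Y) (simp add: power_mult_distrib)
  also have "(1 + Y) ^ n = (\<Sum>a\<le>n. of_nat (n choose a) * Y ^ a)"
    using binomial_ring[of Y 1 n] by (simp add: add.commute)
  also have "(1 + fps_const q * Y) ^ n = (\<Sum>b\<le>n. of_nat (n choose b) * (fps_const q * Y) ^ b)"
    using binomial_ring[of "fps_const q * Y" 1 n] by (simp add: add.commute)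
  also have "(\<Sum>a\<le>n. of_nat (n choose a) * Y ^ a) * \<dots>
      = (\<Sum>j\<in>{..n} \<times> {..n}. fps_const (c j) * Y ^ (fst j + snd j))"
    unfolding sum_product sum.cartesian_product
    by (intro sum.cong)
      (auto simp: c_def power_mult_distrib power_add fps_of_nat[symmetric] algebra_simps
        simp flip: fps_const_mult fps_const_power)
  finally have "of_nat n * Y $ n = (\<Sum>j\<in>{j\<in>{..n} \<times> {..n}. fst j + snd j + 1 = n}. c j)"
    by (intro fps_lagrange_inversion) (auto simp: Y0 Y1[simplified])
  also have "\<dots> = (\<Sum>k<n. of_nat ((n choose k) * (n choose (k + 1))) * q ^ k)"
  proof (rule sum.reindex_bij_witness[where i = "\<lambda>k. (n - 1 - k, k)" and j = snd])
    fix j assume "j \<in> {j\<in>{..n} \<times> {..n}. fst j + snd j + 1 = n}"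
    then obtain a b where j: "j = (a, b)" "a + b + 1 = n" by (cases j) auto
    then have "a = n - (b + 1)" "b + 1 \<le> n" by auto
    then have "n choose a = n choose (b + 1)" by (metis binomial_symmetric)
    then show "of_nat ((n choose snd j) * (n choose (snd j + 1))) * q ^ snd j = c j"
      by (simp add: c_def j)
  qed auto
  \<comment> \<open>The additional term \<open>k = n\<close> vanishes because
    \<open>n choose (n + 1)\<close> is 0.\<close>
  also have "\<dots> = (\<Sum>k\<le>n. of_nat ((n choose k) * (n choose (k + 1))) * q ^ k)"
    by (simp add: lessThan_Suc_atMost[symmetric])
  finally show ?thesis by (simp add: Y_def)
qed

text \<open>The equation is quadratic in \<open>F\<close>. Completing the square shows that
  \<open>D\<close> squares to the discriminant, and its constant term 1 identifies it as the chosen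
  square root; \<open>D\<close> is linear in \<open>F\<close> and can be solved for it.\<close>

lemma narayana_equation_closed_form:
  fixes F :: "'a::field_char_0 fps"
  assumes F: "F = 1 + fps_X * F * (1 + fps_const q * (F - 1))" and q: "q \<noteq> 0"
  shows "F = (1 + fps_X * fps_const (q - 1)
              - fps_sqrt (1 - 2 * fps_X * fps_const (q + 1) + fps_X ^ 2 * fps_const (q - 1) ^ 2))
           / (2 * fps_X * fps_const q)"
proof -
  define Q where "Q = fps_const q"
  define D where "D = 1 + fps_X * (Q - 1) - 2 * fps_X * Q * F"
  have Qm: "fps_const (q - 1) = Q - 1" "fps_const (q + 1) = Q + 1"
    by (simp_all add: Q_def flip: fps_const_sub fps_const_add)
  have "F * (1 + fps_X * (Q - 1)) - fps_X * Q * F ^ 2 = 1"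
    using F by (simp add: Q_def algebra_simps power2_eq_square)
  moreover have "D ^ 2 = (1 + fps_X * (Q - 1)) ^ 2
      - 4 * fps_X * Q * (F * (1 + fps_X * (Q - 1)) - fps_X * Q * F ^ 2)"
    by (simp add: D_def power2_eq_square algebra_simps)
  ultimately have "D ^ 2 = 1 - 2 * fps_X * (Q + 1) + fps_X ^ 2 * (Q - 1) ^ 2"
    by (simp add: power2_eq_square algebra_simps)
  moreover have "D $ 0 = 1" by (simp add: D_def)
  ultimately have "D = fps_sqrt (1 - 2 * fps_X * (Q + 1) + fps_X ^ 2 * (Q - 1) ^ 2)"
    by (subst fps_sqrt_unique[symmetric]) (auto simp: mult.assoc)
  then have "1 + fps_X * (Q - 1) - fps_sqrt (1 - 2 * fps_X * (Q + 1) + fps_X ^ 2 * (Q - 1) ^ 2)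
      = (2 * fps_X * Q) * F"
    unfolding D_def by (metis diff_diff_eq2 add_diff_cancel_left')
  moreover have "2 * fps_X * Q \<noteq> 0"
    using q by (simp add: Q_def)
  ultimately show ?thesis
    unfolding Qm Q_def[symmetric] by simp
qed

section \<open>Comparing coefficients in q\<close>

lemma q_var_neq_0: "q_var \<noteq> 0"
  by (simp add: q_var_def)

lemma to_fract_power [simp]: "to_fract (x ^ n) = to_fract x ^ n"
  by (induction n) auto

lemma to_fract_of_nat [simp]: "to_fract (of_nat n) = of_nat n"
  by (induction n) auto

text \<open>Both sides are images of polynomials under the injective map \<open>to_fract\<close>, so
  the identity already holds between polynomials, where coefficients can be compared. The factor
  \<open>n\<close> on the left is the one that Lagrange inversion produces.\<close>

lemma card_eq_if_sum_q_var_power_eq: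
  assumes "finite S"
    and eq: "of_nat n * (\<Sum>x\<in>S. q_var ^ s x) = (\<Sum>k\<in>K. of_nat (c k) * q_var ^ k)" and "finite K"
  shows "n * card {x\<in>S. s x = k} = (if k \<in> K then c k else 0)"
proof -
  define X where "X = [:0, 1 :: rat:]"
  have coeff_X: "poly.coeff (X ^ j) k = (if k = j then 1 else 0)" for j k
    by (simp add: X_def monom_altdef[of 1, simplified, symmetric])
  have "to_fract (of_nat n * (\<Sum>x\<in>S. X ^ s x)) = to_fract (\<Sum>k\<in>K. of_nat (c k) * X ^ k)"
    using eq by (simp add: q_var_def X_def)
  then have "of_nat n * (\<Sum>x\<in>S. X ^ s x) = (\<Sum>k\<in>K. of_nat (c k) * X ^ k)"
    unfolding to_fract_eq_iff .
  from arg_cong[OF this, of "\<lambda>p. poly.coeff p k"]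
  have "of_nat n * (\<Sum>x\<in>S. if k = s x then 1 else 0)
      = (\<Sum>j\<in>K. of_nat (c j) * (if k = j then 1 else 0 :: rat))"
    by (simp add: coeff_sum coeff_X of_nat_poly)
  also have "(\<Sum>x\<in>S. if k = s x then 1 else 0 :: rat) = of_nat (card {x\<in>S. s x = k})"
    using \<open>finite S\<close> by (simp add: sum.If_cases Int_def eq_commute conj_commute)
  also have "(\<Sum>j\<in>K. of_nat (c j) * (if k = j then 1 else 0 :: rat))
      = of_nat (if k \<in> K then c k else 0)"
    using \<open>finite K\<close> by (simp add: if_distrib[of "(*) _"] cong: if_cong)
  finally show ?thesis unfolding of_nat_mult[symmetric] of_nat_eq_iff .
qed

text \<open>The common last step of both counts: it applies to any statistic \<open>s\<close> whose
  generating function satisfies the functional equation.\<close>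

lemma narayana_card:
  assumes F: "F = 1 + fps_X * F * (1 + fps_const q_var * (F - 1))"
    and Fn: "F $ n = (\<Sum>x\<in>S. q_var ^ s x)" and "finite S" "n \<ge> 1"
  shows "of_nat (card {x\<in>S. s x = k}) = narayana n k"
proof -
  have "of_nat n * (\<Sum>x\<in>S. q_var ^ s x)
      = (\<Sum>k\<le>n. of_nat ((n choose k) * (n choose (k + 1))) * q_var ^ k)"
    using narayana_equation_coeff[OF F, of n] Fn \<open>n \<ge> 1\<close> by simp
  from card_eq_if_sum_q_var_power_eq[OF \<open>finite S\<close> this, of k]
  have "n * card {x\<in>S. s x = k} = (n choose k) * (n choose (k + 1))"
    by (cases "k \<le> n") auto
  from arg_cong[OF this, of "of_nat :: _ \<Rightarrow> rat"] show ?thesis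
    using \<open>n \<ge> 1\<close> by (simp add: narayana_def field_simps)
qed

section \<open>Dumont permutations avoiding 3142\<close>

text \<open>The values 1, 2, 3, 4 of the pattern stand at the positions \<open>b\<close>,
  \<open>d\<close>, \<open>a\<close>, \<open>c\<close>; the resulting chain of three inequalities
  decides all pairwise comparisons.\<close>

lemma contains_3142_iff:
  "contains_pattern N \<pi> [3,1,4,2] \<longleftrightarrow>
     (\<exists>a b c d. 1 \<le> a \<and> a < b \<and> b < c \<and> c < d \<and> d \<le> N \<and> \<pi> b < \<pi> d \<and> \<pi> d < \<pi> a \<and> \<pi> a < \<pi> c)"
proof
  have len: "length [3,1,4,2::nat] = 4" by simp
  assume "contains_pattern N \<pi> [3,1,4,2]"
  then obtain p where p: "strict_mono_on {..<4::nat} p" "p ` {..<4} \<subseteq> {1..N}"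
    and o: "\<forall>a<4. \<forall>b<4. \<pi> (p a) < \<pi> (p b) \<longleftrightarrow> [3,1,4,2::nat] ! a < [3,1,4,2] ! b"
    unfolding contains_pattern_def len by blast
  have "p 0 < p 1" "p 1 < p 2" "p 2 < p 3"
    by (auto intro!: strict_mono_onD[OF p(1)])
  moreover have "1 \<le> p 0" "p 3 \<le> N"
    using p(2)[THEN subsetD, of "p 0"] p(2)[THEN subsetD, of "p 3"] by auto
  moreover have "\<pi> (p 1) < \<pi> (p 3)" "\<pi> (p 3) < \<pi> (p 0)" "\<pi> (p 0) < \<pi> (p 2)"
    by (simp_all add: o)
  ultimately show "\<exists>a b c d. 1 \<le> a \<and> a < b \<and> b < c \<and> c < d \<and> d \<le> N \<and> \<pi> b < \<pi> d \<and> \<pi> d < \<pi> a \<and> \<pi> a < \<pi> c"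
    by blast
next
  assume "\<exists>a b c d. 1 \<le> a \<and> a < b \<and> b < c \<and> c < d \<and> d \<le> N \<and> \<pi> b < \<pi> d \<and> \<pi> d < \<pi> a \<and> \<pi> a < \<pi> c"
  then obtain a b c d where *: "1 \<le> a" "a < b" "b < c" "c < d" "d \<le> N"
    "\<pi> b < \<pi> d" "\<pi> d < \<pi> a" "\<pi> a < \<pi> c" by blast
  have 4: "{..<length [3,1,4,2::nat]} = {0,1,2,3}" by auto
  have lt4: "(\<forall>i<length [3,1,4,2::nat]. P i) \<longleftrightarrow> P 0 \<and> P 1 \<and> P 2 \<and> P 3" for P
    using 4 by (metis (no_types, lifting) insert_iff lessThan_iff empty_iff)
  show "contains_pattern N \<pi> [3,1,4,2]"
    unfolding contains_pattern_def lt4 unfolding 4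
    using * by (intro exI[of _ "(!) [a, b, c, d]"]) (auto simp: strict_mono_on_def)
qed

definition dumont2_3142 :: "nat \<Rightarrow> (nat \<Rightarrow> nat) set" where
  "dumont2_3142 n = dumont2_avoiding n [3,1,4,2]"

text \<open>Parity of the position replaces the pairs \<open>2*i - 1\<close>, \<open>2*i\<close>.
  This form suits the block decomposition, where an even translation keeps parity and the reflection
  of positions reverses it.\<close>

lemma dumont2_3142_iff:
  "\<pi> \<in> dumont2_3142 n \<longleftrightarrow> \<pi> permutes {1..2*n}
     \<and> (\<forall>i\<in>{1..2*n}. if even i then \<pi> i < i else i \<le> \<pi> i)
     \<and> (\<forall>a b c d. 1 \<le> a \<longrightarrow> a < b \<longrightarrow> b < c \<longrightarrow> c < d \<longrightarrow> d \<le> 2*n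
          \<longrightarrow> \<pi> b < \<pi> d \<longrightarrow> \<pi> d < \<pi> a \<longrightarrow> \<not> \<pi> a < \<pi> c)"
proof -
  have "(\<forall>i\<in>{1..n}. \<pi> (2*i) < 2*i \<and> 2*i - 1 \<le> \<pi> (2*i - 1))
      \<longleftrightarrow> (\<forall>i\<in>{1..2*n}. if even i then \<pi> i < i else i \<le> \<pi> i)" (is "?l \<longleftrightarrow> ?r")
  proof
    assume l: ?l
    show ?r
    proof
      fix i assume i: "i \<in> {1..2*n}"
      show "if even i then \<pi> i < i else i \<le> \<pi> i"
      proof (cases "even i")
        case True
        then obtain j where "i = 2 * j" by blast
        then show ?thesis using l i by auto
      next
        case False
        then obtain j where "i = 2 * j + 1" using oddE by blast
        then show ?thesis using l[rule_format, of "j + 1"] i by auto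
      qed
    qed
  next
    assume r: ?r
    show ?l
    proof
      fix i assume i: "i \<in> {1..n}"
      then have "2 * i \<in> {1..2*n}" "2 * i - 1 \<in> {1..2*n}" "odd (2 * i - 1)" by auto
      then show "\<pi> (2*i) < 2*i \<and> 2*i - 1 \<le> \<pi> (2*i - 1)"
        using bspec[OF r, of "2*i"] bspec[OF r, of "2*i - 1"] by simp
    qed
  qed
  moreover have "\<not> contains_pattern (2*n) \<pi> [3,1,4,2] \<longleftrightarrow>
      (\<forall>a b c d. 1 \<le> a \<longrightarrow> a < b \<longrightarrow> b < c \<longrightarrow> c < d \<longrightarrow> d \<le> 2*n
          \<longrightarrow> \<pi> b < \<pi> d \<longrightarrow> \<pi> d < \<pi> a \<longrightarrow> \<not> \<pi> a < \<pi> c)"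
    unfolding contains_3142_iff by blast
  ultimately show ?thesis
    unfolding dumont2_3142_def dumont2_avoiding_def dumont2_def avoids_pattern_def mem_Collect_eq
    by (simp only: conj_assoc)
qed

text \<open>
  In \<open>(2k + 2, 1, rc(\<sigma>) + 1) \<oplus> \<tau>\<close> the positions of \<open>rc(\<sigma>)\<close> move by 2 and its values by 1; this turns
  fixed points of \<open>\<sigma>\<close> into drops and drops into fixed points.
\<close>
definition num_drops :: "nat \<Rightarrow> (nat \<Rightarrow> nat) \<Rightarrow> nat" where
  "num_drops N \<pi> = card {i\<in>{1..N}. \<pi> i + 1 = i}"

text \<open>
  \<open>glue (k, \<sigma>, \<tau>)\<close> is \<open>(2k + 2, 1, rc(\<sigma>) + 1) \<oplus> \<tau>\<close>, for \<open>\<sigma>\<close> of length \<open>2k\<close>.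
\<close>
definition glue :: "nat \<times> (nat \<Rightarrow> nat) \<times> (nat \<Rightarrow> nat) \<Rightarrow> nat \<Rightarrow> nat" where
  "glue = (\<lambda>(k, \<sigma>, \<tau>) x.
     if x = 0 then 0
     else if x = 1 then 2*k + 2
     else if x = 2 then 1
     else if x \<le> 2*k + 2 then 2*k + 2 - \<sigma> (2*k + 3 - x)
     else \<tau> (x - (2*k + 2)) + (2*k + 2))"

text \<open>Intended inverse of \<open>glue\<close>: the first block occupies the positions and
  values up to \<open>\<pi> 1 = 2*k + 2\<close>. For the permutations considered here, both
  components come out as the identity outside their ranges, as \<open>permutes\<close>
  demands.\<close>

definition unglue :: "(nat \<Rightarrow> nat) \<Rightarrow> nat \<times> (nat \<Rightarrow> nat) \<times> (nat \<Rightarrow> nat)" where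
  "unglue \<pi> = (\<pi> 1 div 2 - 1,
     \<lambda>i. if 1 \<le> i \<and> i + 2 \<le> \<pi> 1 then \<pi> 1 - \<pi> (\<pi> 1 + 1 - i) else i,
     \<lambda>i. if i = 0 then 0 else \<pi> (i + \<pi> 1) - \<pi> 1)"

section \<open>The bijection between permutations and triples\<close>

lemma permutesI_nat:
  fixes f :: "nat \<Rightarrow> nat"
  assumes "\<And>x. x \<in> {1..N} \<Longrightarrow> f x \<in> {1..N}" "\<And>x. x \<notin> {1..N} \<Longrightarrow> f x = x"
    and "\<And>x y. x \<in> {1..N} \<Longrightarrow> y \<in> {1..N} \<Longrightarrow> f x = f y \<Longrightarrow> x = y"
  shows "f permutes {1..N}"
proof (rule bij_imp_permutes)
  have "inj_on f {1..N}" using assms(3) by (auto intro: inj_onI)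
  moreover have "f ` {1..N} \<subseteq> {1..N}" using assms(1) by blast
  ultimately show "bij_betw f {1..N} {1..N}"
    by (simp add: bij_betw_def endo_inj_surj)
qed (use assms(2) in auto)

lemma dumont2_3142D:
  assumes "\<pi> \<in> dumont2_3142 n"
  shows "1 \<le> i \<Longrightarrow> i \<le> 2*n \<Longrightarrow> 1 \<le> \<pi> i" "1 \<le> i \<Longrightarrow> i \<le> 2*n \<Longrightarrow> \<pi> i \<le> 2*n"
    and "\<not> (1 \<le> i \<and> i \<le> 2*n) \<Longrightarrow> \<pi> i = i"
    and "\<pi> i = \<pi> j \<longleftrightarrow> i = j"
    and "1 \<le> i \<Longrightarrow> i \<le> 2*n \<Longrightarrow> even i \<Longrightarrow> \<pi> i < i" "1 \<le> i \<Longrightarrow> i \<le> 2*n \<Longrightarrow> odd i \<Longrightarrow> i \<le> \<pi> i"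
    and "1 \<le> a \<Longrightarrow> a < b \<Longrightarrow> b < c \<Longrightarrow> c < d \<Longrightarrow> d \<le> 2*n \<Longrightarrow> \<pi> b < \<pi> d \<Longrightarrow> \<pi> d < \<pi> a \<Longrightarrow> \<not> \<pi> a < \<pi> c"
proof -
  have p: "\<pi> permutes {1..2*n}" using assms unfolding dumont2_3142_iff by blast
  have "\<pi> i \<in> {1..2*n} \<longleftrightarrow> i \<in> {1..2*n}" using permutes_in_image[OF p] .
  then show "1 \<le> i \<Longrightarrow> i \<le> 2*n \<Longrightarrow> 1 \<le> \<pi> i" "1 \<le> i \<Longrightarrow> i \<le> 2*n \<Longrightarrow> \<pi> i \<le> 2*n" by auto
  show "\<not> (1 \<le> i \<and> i \<le> 2*n) \<Longrightarrow> \<pi> i = i" using permutes_not_in[OF p, of i] by auto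
  show "\<pi> i = \<pi> j \<longleftrightarrow> i = j" using permutes_inj[OF p] by (auto dest: injD)
  show "1 \<le> i \<Longrightarrow> i \<le> 2*n \<Longrightarrow> even i \<Longrightarrow> \<pi> i < i" "1 \<le> i \<Longrightarrow> i \<le> 2*n \<Longrightarrow> odd i \<Longrightarrow> i \<le> \<pi> i"
    using assms unfolding dumont2_3142_iff by (metis atLeastAtMost_iff)+
  show "1 \<le> a \<Longrightarrow> a < b \<Longrightarrow> b < c \<Longrightarrow> c < d \<Longrightarrow> d \<le> 2*n \<Longrightarrow> \<pi> b < \<pi> d \<Longrightarrow> \<pi> d < \<pi> a \<Longrightarrow> \<not> \<pi> a < \<pi> c"
    using assms unfolding dumont2_3142_iff by blast
qed

lemma dumont2_3142I:
  assumes "\<And>i. 1 \<le> i \<Longrightarrow> i \<le> 2*n \<Longrightarrow> 1 \<le> \<pi> i \<and> \<pi> i \<le> 2*n"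
    and "\<And>i. \<not> (1 \<le> i \<and> i \<le> 2*n) \<Longrightarrow> \<pi> i = i"
    and "\<And>i j. 1 \<le> i \<Longrightarrow> i < j \<Longrightarrow> j \<le> 2*n \<Longrightarrow> \<pi> i \<noteq> \<pi> j"
    and "\<And>i. 1 \<le> i \<Longrightarrow> i \<le> 2*n \<Longrightarrow> even i \<Longrightarrow> \<pi> i < i"
    and "\<And>i. 1 \<le> i \<Longrightarrow> i \<le> 2*n \<Longrightarrow> odd i \<Longrightarrow> i \<le> \<pi> i"
    and "\<And>a b c d. 1 \<le> a \<Longrightarrow> a < b \<Longrightarrow> b < c \<Longrightarrow> c < d \<Longrightarrow> d \<le> 2*n \<Longrightarrow> \<pi> b < \<pi> d \<Longrightarrow> \<pi> d < \<pi> a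
      \<Longrightarrow> \<pi> a < \<pi> c \<Longrightarrow> False"
  shows "\<pi> \<in> dumont2_3142 n"
proof -
  have "\<pi> permutes {1..2*n}"
  proof (rule permutesI_nat)
    fix x y assume "x \<in> {1..2*n}" "y \<in> {1..2*n}" "\<pi> x = \<pi> y"
    then show "x = y" using assms(3)[of x y] assms(3)[of y x] by (cases x y rule: linorder_cases) auto
  qed (use assms(1,2) in auto)
  then show ?thesis
    unfolding dumont2_3142_iff using assms(4-6) by auto
qed

text \<open>Inside the first block, an occurrence of 3142 would give one in \<open>\<sigma>\<close>,
  since the pattern equals its own reverse complement. An occurrence ending in the second block lies
  in it entirely, because its first value exceeds its last.\<close>

lemma glue_in_dumont2_3142:
  assumes k: "k \<le> n" and \<sigma>: "\<sigma> \<in> dumont2_3142 k" and \<tau>: "\<tau> \<in> dumont2_3142 (n - k)"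
  shows "glue (k, \<sigma>, \<tau>) \<in> dumont2_3142 (Suc n)"
proof -
  define g where "g = glue (k, \<sigma>, \<tau>)"
  define K where "K = 2*k + 2"
  have g1: "g 1 = K" "g 2 = 1"
    by (simp_all add: g_def glue_def K_def)
  \<comment> \<open>The reflection of positions that maps 3 to \<open>K\<close> onto
    \<open>2*k\<close> to 1. The facts about \<open>r\<close> and \<open>g\<close> are stated as
    sums to keep truncated subtraction out of the arithmetic.\<close>
  define r where "r x = K + 1 - x" for x
  have r: "r x + x = K + 1" if "x \<le> K" for x using that by (simp add: r_def)
  have gm: "g x + \<sigma> (r x) = K" "1 < g x" "g x < K" if x: "3 \<le> x" "x \<le> K" for x
  proof -
    have rx: "1 \<le> r x" "r x \<le> 2*k" using x r[of x] unfolding K_def by linarith+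
    have "2*k + 3 - x = r x" by (simp add: r_def K_def)
    then have "g x = K - \<sigma> (r x)" using x by (simp add: g_def glue_def K_def)
    moreover have "1 \<le> \<sigma> (r x)" "\<sigma> (r x) \<le> 2*k" using rx dumont2_3142D(1,2)[OF \<sigma>] by auto
    ultimately show "g x + \<sigma> (r x) = K" "1 < g x" "g x < K" by (simp_all add: K_def)
  qed
  have gt: "g x = \<tau> (x - K) + K" if "K < x" for x
    using that by (simp add: g_def glue_def K_def)
  have gt_le: "K < g x" "g x \<le> 2 * Suc n" if "K < x" "x \<le> 2 * Suc n" for x
  proof -
    have "1 \<le> x - K" "x - K \<le> 2 * (n - k)" using that k by (simp_all add: K_def)
    then have "1 \<le> \<tau> (x - K)" "\<tau> (x - K) \<le> 2 * (n - k)" using dumont2_3142D(1,2)[OF \<tau>] by auto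
    then show "K < g x" "g x \<le> 2 * Suc n" using gt[of x] that k by (simp_all add: K_def)
  qed
  have small: "1 \<le> g x \<and> g x \<le> K" if x: "1 \<le> x" "x \<le> K" for x
  proof -
    consider "x = 1" | "x = 2" | "3 \<le> x" using x by linarith
    then show ?thesis using x gm(2,3)[of x] by cases (auto simp: g1 g1(1)[simplified] K_def)
  qed
  have K: "K \<le> 2 * Suc n" "even K" "2 \<le> K" using k by (auto simp: K_def)
  show ?thesis unfolding g_def[symmetric]
  proof (rule dumont2_3142I)
    fix i assume i: "1 \<le> i" "i \<le> 2 * Suc n"
    show "1 \<le> g i \<and> g i \<le> 2 * Suc n"
      using small[of i] gt_le[of i] i K by (cases "i \<le> K") auto
  next
    fix i assume i: "\<not> (1 \<le> i \<and> i \<le> 2 * Suc n)"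
    show "g i = i"
    proof (cases "i = 0")
      case False
      then have "\<tau> (i - K) = i - K" using i k by (intro dumont2_3142D(3)[OF \<tau>]) (auto simp: K_def)
      then show ?thesis using gt[of i] i K False by auto
    qed (simp add: g_def glue_def)
  next
    fix i j assume ij: "1 \<le> i" "i < j" "j \<le> 2 * Suc n"
    show "g i \<noteq> g j"
    proof (cases "j \<le> K")
      case True
      consider "i = 1" "j = 2" | "i = 1" "3 \<le> j" | "i = 2" "3 \<le> j" | "3 \<le> i" "3 \<le> j" using ij by linarith
      then show ?thesis
      proof cases
        case 4
        have "\<sigma> (r i) \<noteq> \<sigma> (r j)" using ij True r[of i] r[of j]
          unfolding dumont2_3142D(4)[OF \<sigma>] by linarith
        then show ?thesis using gm(1)[of i] gm(1)[of j] 4 ij True by linarith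
      qed (use gm(2,3)[of j] g1 K True in auto)
    next
      case False
      show ?thesis
      proof (cases "i \<le> K")
        case True
        then show ?thesis using small[of i] gt_le[of j] False ij by auto
      next
        case F: False
        then show ?thesis using False ij by (auto simp: gt dumont2_3142D(4)[OF \<tau>])
      qed
    qed
  next
    fix i assume i: "1 \<le> i" "i \<le> 2 * Suc n" "even i"
    then have "i \<noteq> 1" by auto
    with i(1) consider "i = 2" | "3 \<le> i" "i \<le> K" | "K < i" by linarith
    then show "g i < i"
    proof cases
      case 2
      \<comment> \<open>The sum \<open>r i + i = K + 1\<close> is odd, so \<open>r i\<close> has the
        other parity. The inequality \<open>r i \<le> \<sigma> (r i)\<close> then gives
        \<open>g i \<le> K - r i = i - 1\<close>; the shift by one makes weak and strict
        inequalities change places.\<close>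
      then have "even (r i + i) = False" "1 \<le> r i" "r i \<le> 2*k" using r[of i] K by (simp_all add: K_def)
      then have "r i \<le> \<sigma> (r i)" using i(3) by (intro dumont2_3142D(6)[OF \<sigma>]) simp_all
      then show ?thesis using gm(1)[of i] r[of i] 2 by linarith
    next
      case 3
      then have "\<tau> (i - K) < i - K" using i K k
        by (intro dumont2_3142D(5)[OF \<tau>]) (auto simp: K_def)
      then show ?thesis using gt[of i] 3 by auto
    qed (use g1 in auto)
  next
    fix i assume i: "1 \<le> i" "i \<le> 2 * Suc n" "odd i"
    then have "i \<noteq> 2" by auto
    with i(1) consider "i = 1" | "3 \<le> i" "i \<le> K" | "K < i" by linarith
    then show "i \<le> g i"
    proof cases
      case 2
      then have "even (r i + i) = False" "1 \<le> r i" "r i \<le> 2*k" using r[of i] K by (simp_all add: K_def)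
      then have "\<sigma> (r i) < r i" using i(3) by (intro dumont2_3142D(5)[OF \<sigma>]) simp_all
      then show ?thesis using gm(1)[of i] r[of i] 2 by linarith
    next
      case 3
      then have "i - K \<le> \<tau> (i - K)" using i K k
        by (intro dumont2_3142D(6)[OF \<tau>]) (auto simp: K_def)
      then show ?thesis using gt[of i] 3 by auto
    qed (use g1 K in auto)
  next
    fix a b c d
    assume abcd: "1 \<le> a" "a < b" "b < c" "c < d" "d \<le> 2 * Suc n" "g b < g d" "g d < g a" "g a < g c"
    show False
    proof (cases "d \<le> K")
      case True
      \<comment> \<open>Position 1 carries the largest value of the block and position 2 the
        smallest, so neither can be the 3 of the pattern.\<close>
      have "a \<noteq> 1" using abcd small[of c] True g1 by auto
      moreover have "a \<noteq> 2" using abcd small[of b] True g1 by auto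
      ultimately have a: "3 \<le> a" using abcd by auto
      \<comment> \<open>Reflection reverses both positions and values, so \<open>r d\<close>,
        \<open>r c\<close>, \<open>r b\<close>, \<open>r a\<close> again form 3142.\<close>
      have v: "\<sigma> (r c) < \<sigma> (r a)" "\<sigma> (r a) < \<sigma> (r d)" "\<sigma> (r d) < \<sigma> (r b)"
        using abcd a True gm(1)[of a] gm(1)[of b] gm(1)[of c] gm(1)[of d] by linarith+
      have p: "1 \<le> r d" "r d < r c" "r c < r b" "r b < r a" "r a \<le> 2*k"
        using abcd a True r[of a] r[of b] r[of c] r[of d] unfolding K_def by linarith+
      show False using dumont2_3142D(7)[OF \<sigma> p v(1,2)] v(3) by contradiction
    next
      case False
      then have "K < g a" using gt_le[of d] abcd by auto
      then have a: "K < a" using small[of a] abcd by (cases "a \<le> K") auto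
      have v: "\<tau> (b - K) < \<tau> (d - K)" "\<tau> (d - K) < \<tau> (a - K)" "\<tau> (a - K) < \<tau> (c - K)"
        using abcd(2-4,6-8) a unfolding gt[OF a] by (simp_all add: gt)
      have p: "1 \<le> a - K" "a - K < b - K" "b - K < c - K" "c - K < d - K" "d - K \<le> 2*(n - k)"
        using abcd(1-5) a k by (simp_all add: K_def)
      show False using dumont2_3142D(7)[OF \<tau> p v(1,2)] v(3) by contradiction
    qed
  qed
qed

lemma unglue_glue:
  assumes k: "k \<le> n" and \<sigma>: "\<sigma> \<in> dumont2_3142 k" and \<tau>: "\<tau> \<in> dumont2_3142 (n - k)"
  shows "unglue (glue (k, \<sigma>, \<tau>)) = (k, \<sigma>, \<tau>)"
proof -
  have 1: "glue (k, \<sigma>, \<tau>) 1 = 2*k + 2" by (simp add: glue_def)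
  have "(if 1 \<le> i \<and> i + 2 \<le> 2*k + 2
      then 2*k + 2 - glue (k, \<sigma>, \<tau>) (2*k + 2 + 1 - i) else i) = \<sigma> i" for i
  proof (cases "1 \<le> i \<and> i \<le> 2*k")
    case True
    define x where "x = 2*k + 2 + 1 - i"
    have x: "2*k + 3 - x = i" "3 \<le> x" "x \<le> 2*k + 2" using True by (auto simp: x_def)
    then have "glue (k, \<sigma>, \<tau>) x = 2*k + 2 - \<sigma> i" by (simp add: glue_def)
    then show ?thesis unfolding x_def[symmetric] using True dumont2_3142D(2)[OF \<sigma>, of i] by simp
  next
    case False
    then have "\<not> (1 \<le> i \<and> i + 2 \<le> 2*k + 2)" by simp
    then show ?thesis using dumont2_3142D(3)[OF \<sigma> False] by (simp only: if_False)
  qed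
  moreover have "(if i = 0 then 0 else glue (k, \<sigma>, \<tau>) (i + (2*k + 2)) - (2*k + 2)) = \<tau> i" for i
    using dumont2_3142D(3)[OF \<tau>, of 0] by (simp add: glue_def)
  ultimately show ?thesis
    unfolding unglue_def 1 by (simp add: fun_eq_iff)
qed

text \<open>
  Since \<open>\<pi> 2 = 1\<close>, avoiding 3142 forces the values below \<open>\<pi> 1\<close> to precede the larger ones.
\<close>
lemma dumont2_3142_block:
  assumes "\<pi> \<in> dumont2_3142 (Suc n)"
  shows "\<pi> 2 = 1" "2 \<le> \<pi> 1" "\<pi> 1 \<le> 2 * Suc n" "even (\<pi> 1)"
    and "1 \<le> i \<Longrightarrow> i \<le> \<pi> 1 \<Longrightarrow> \<pi> i \<le> \<pi> 1"
    and "\<pi> 1 < i \<Longrightarrow> \<pi> 1 < \<pi> i"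
proof -
  note D = dumont2_3142D[OF assms]
  show 2: "\<pi> 2 = 1" using D(1)[of 2] D(5)[of 2] by simp
  show m: "2 \<le> \<pi> 1" using D(1)[of 1] D(4)[of 1 2] 2 by simp
  show m2: "\<pi> 1 \<le> 2 * Suc n" using D(2)[of 1] by simp
  \<comment> \<open>A value above \<open>\<pi> 1\<close> at \<open>j\<close>, followed by a value
    below \<open>\<pi> 1\<close> at \<open>i\<close>, would form 3142 at the positions 1, 2,
    \<open>j\<close>, \<open>i\<close>.\<close>
  have before: "\<pi> j \<le> \<pi> 1" if "1 \<le> j" "j < i" "i \<le> 2 * Suc n" "\<pi> i \<le> \<pi> 1" for i j
  proof (rule ccontr)
    assume j: "\<not> \<pi> j \<le> \<pi> 1"
    then have j2: "2 < j" using that 2 m by (cases "j = 1"; cases "j = 2") auto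
    then have "\<pi> i \<noteq> \<pi> 1" "\<pi> i \<noteq> \<pi> 2" using that unfolding D(4) by auto
    moreover have "1 \<le> \<pi> i" using that D(1)[of i] by simp
    ultimately show False using D(7)[of 1 2 j i] that j j2 2 by auto
  qed
  \<comment> \<open>The set \<open>S\<close> is closed downwards by \<open>before\<close> and has
    \<open>\<pi> 1\<close> elements, so it consists of the first \<open>\<pi> 1\<close>
    positions.\<close>
  define S where "S = {i\<in>{1..2 * Suc n}. \<pi> i \<le> \<pi> 1}"
  have p: "\<pi> permutes {1..2 * Suc n}" using assms unfolding dumont2_3142_iff by blast
  have img: "\<pi> ` S = {1..\<pi> 1}"
  proof
    show "\<pi> ` S \<subseteq> {1..\<pi> 1}"
    proof
      fix v assume "v \<in> \<pi> ` S"
      then obtain i where "v = \<pi> i" "1 \<le> i" "i \<le> 2 * Suc n" "\<pi> i \<le> \<pi> 1"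
        unfolding S_def by fastforce
      then show "v \<in> {1..\<pi> 1}" using D(1)[of i] by simp
    qed
    show "{1..\<pi> 1} \<subseteq> \<pi> ` S"
    proof
      fix v assume v: "v \<in> {1..\<pi> 1}"
      then have "v \<in> {1..2 * Suc n}" using m2 unfolding atLeastAtMost_iff by linarith
      then obtain i where "i \<in> {1..2 * Suc n}" "v = \<pi> i" using permutes_image[OF p] by blast
      moreover from this have "i \<in> S" using v unfolding S_def by simp
      ultimately show "v \<in> \<pi> ` S" by blast
    qed
  qed
  have card: "card S = \<pi> 1"
    using card_image[of \<pi> S] img permutes_inj_on[OF p, of S] by simp
  have finS: "finite S" by (simp add: S_def)
  have S_le: "i \<le> \<pi> 1" if "i \<in> S" for i
  proof -
    have "j \<in> S" if "j \<in> {1..i}" for j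
      using that \<open>i \<in> S\<close> before[of j i] unfolding S_def by (cases "j = i") simp_all
    then have "{1..i} \<subseteq> S" by blast
    then show ?thesis using card_mono[OF finS, of "{1..i}"] card by simp
  qed
  have "S \<subseteq> {1..\<pi> 1}"
  proof
    fix i assume "i \<in> S"
    then show "i \<in> {1..\<pi> 1}" using S_le[of i] by (simp add: S_def)
  qed
  then have S: "S = {1..\<pi> 1}" using card by (intro card_subset_eq) auto
  show "1 \<le> i \<Longrightarrow> i \<le> \<pi> 1 \<Longrightarrow> \<pi> i \<le> \<pi> 1"
  proof -
    assume "1 \<le> i" "i \<le> \<pi> 1"
    then have "i \<in> S" unfolding S by simp
    then show "\<pi> i \<le> \<pi> 1" by (simp add: S_def)
  qed
  show "\<pi> 1 < i \<Longrightarrow> \<pi> 1 < \<pi> i"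
  proof -
    assume i: "\<pi> 1 < i"
    then have "i \<notin> S" unfolding S by simp
    then show "\<pi> 1 < \<pi> i"
      using i D(3)[of i] by (cases "i \<le> 2 * Suc n") (simp_all add: S_def not_le)
  qed
  show "even (\<pi> 1)"
  proof (rule ccontr)
    \<comment> \<open>At the odd position \<open>\<pi> 1\<close> the Dumont condition and the block
      bound would make the value equal to \<open>\<pi> 1\<close>, which position 1 already
      has.\<close>
    assume odd: "odd (\<pi> 1)"
    have "\<pi> 1 \<in> S" using S m by auto
    then have "\<pi> (\<pi> 1) \<le> \<pi> 1" by (simp add: S_def)
    moreover have "\<pi> 1 \<le> \<pi> (\<pi> 1)" using D(6)[of "\<pi> 1"] odd m m2 by simp
    ultimately have "\<pi> (\<pi> 1) = \<pi> 1" by simp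
    then show False using D(4) m by simp
  qed
qed

text \<open>By the block structure, the positions from 3 to \<open>K\<close> carry values strictly
  between 1 and \<open>K\<close>, and later positions carry values above \<open>K\<close>. Hence the
  reflection of the former and the translation of the latter can be undone, and they transfer all
  conditions as in the gluing.\<close>

lemma unglue_in_dumont2_3142:
  assumes "\<pi> \<in> dumont2_3142 (Suc n)"
  shows "unglue \<pi> \<in> (SIGMA k:{..n}. dumont2_3142 k \<times> dumont2_3142 (n - k))"
proof -
  note D = dumont2_3142D[OF assms]
  note B = dumont2_3142_block[OF assms]
  define K where "K = \<pi> 1"
  define k where "k = K div 2 - 1"
  have K: "K = 2 * k + 2" using B(2,4) by (auto simp: k_def K_def)
  have k: "k \<le> n" using B(3) K by (simp add: K_def)
  define \<sigma> where "\<sigma> = (\<lambda>i. if 1 \<le> i \<and> i \<le> 2*k then K - \<pi> (K + 1 - i) else i)"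
  define \<tau> where "\<tau> = (\<lambda>i. if i = 0 then 0 else \<pi> (i + K) - K)"
  have u: "unglue \<pi> = (k, \<sigma>, \<tau>)"
    unfolding unglue_def \<sigma>_def \<tau>_def k_def K_def using K by (auto simp: K_def k_def fun_eq_iff)
  have mid: "1 < \<pi> x" "\<pi> x < K" if "3 \<le> x" "x \<le> K" for x
  proof -
    have "\<pi> x \<noteq> \<pi> 1" "\<pi> x \<noteq> \<pi> 2" using that unfolding D(4) by auto
    moreover have "1 \<le> \<pi> x" using D(1)[of x] that B(3) by (simp add: K_def)
    moreover have "\<pi> x \<le> \<pi> 1" using B(5)[of x] that by (simp add: K_def)
    ultimately show "1 < \<pi> x" "\<pi> x < K" using B(1) by (auto simp: K_def)
  qed
  define r where "r i = K + 1 - i" for i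
  have r: "r i + i = K + 1" if "i \<le> K" for i using that by (simp add: r_def)
  have \<sigma>_eq: "\<sigma> i + \<pi> (r i) = K" "1 < \<pi> (r i)" "\<pi> (r i) < K" "r i + i = K + 1"
    if i: "1 \<le> i" "i \<le> 2*k" for i
  proof -
    show "r i + i = K + 1" using r[of i] i K by linarith
    then show "1 < \<pi> (r i)" "\<pi> (r i) < K" using mid[of "r i"] i K by linarith+
    then show "\<sigma> i + \<pi> (r i) = K" using i by (simp add: \<sigma>_def r_def)
  qed
  have \<tau>_eq: "\<tau> i = \<pi> (i + K) - K" if "1 \<le> i" for i
    using that by (simp add: \<tau>_def)
  have "\<sigma> \<in> dumont2_3142 k"
  proof (rule dumont2_3142I)
    fix i assume i: "1 \<le> i" "i \<le> 2*k"
    note e = \<sigma>_eq[OF i]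
    show "1 \<le> \<sigma> i \<and> \<sigma> i \<le> 2*k" using e K by linarith
    have ri: "1 \<le> r i" "r i \<le> 2 * Suc n" using e(4) i K k by simp_all
    have "even (r i + i) = False" unfolding e(4) K by simp
    then have par: "odd (r i) = even i" by simp
    show "\<sigma> i < i" if "even i" using D(6)[OF ri] e that par by linarith
    show "i \<le> \<sigma> i" if "odd i" using D(5)[OF ri] e that par by linarith
  next
    fix i j assume i: "1 \<le> i" "i < j" "j \<le> 2*k"
    then have j: "i \<le> 2*k" "1 \<le> j" by linarith+
    note e = \<sigma>_eq[OF i(1) j(1)] \<sigma>_eq[OF j(2) i(3)]
    have "\<pi> (r i) \<noteq> \<pi> (r j)" using e i(2) unfolding D(4) by linarith
    then show "\<sigma> i \<noteq> \<sigma> j" using e by linarith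
  next
    fix a b c d
    assume a: "1 \<le> a" "a < b" "b < c" "c < d" "d \<le> 2*k" "\<sigma> b < \<sigma> d" "\<sigma> d < \<sigma> a" "\<sigma> a < \<sigma> c"
    have "1 \<le> b" "1 \<le> c" "1 \<le> d" "a \<le> 2*k" "b \<le> 2*k" "c \<le> 2*k" using a(1-5) by linarith+
    note e = \<sigma>_eq[OF \<open>1 \<le> a\<close> \<open>a \<le> 2*k\<close>] \<sigma>_eq[OF \<open>1 \<le> b\<close> \<open>b \<le> 2*k\<close>]
      \<sigma>_eq[OF \<open>1 \<le> c\<close> \<open>c \<le> 2*k\<close>] \<sigma>_eq[OF \<open>1 \<le> d\<close> \<open>d \<le> 2*k\<close>]
    have v: "\<pi> (r c) < \<pi> (r a)" "\<pi> (r a) < \<pi> (r d)" "\<pi> (r d) < \<pi> (r b)"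
      using a(6-8) e by linarith+
    have p: "1 \<le> r d" "r d < r c" "r c < r b" "r b < r a"
      using a(1-5) e K by linarith+
    have "r a \<le> 2 * Suc n" using e(4) a(1) K k by simp
    note p = p this
    show False using D(7)[OF p v(1,2)] v(3) by contradiction
  qed (auto simp: \<sigma>_def)
  moreover have hi: "K < \<pi> (i + K)" if "1 \<le> i" for i
    using B(6)[of "i + K"] that by (simp add: K_def)
  define m where "m = n - k"
  have n: "n = k + m" using k by (simp add: m_def)
  have hi': "\<pi> (i + K) \<le> 2 * m + K" if "1 \<le> i" "i \<le> 2*m" for i
    using D(2)[of "i + K"] that n K by simp
  have "\<tau> \<in> dumont2_3142 m"
  proof (rule dumont2_3142I)
    fix i assume i: "1 \<le> i" "i \<le> 2*m"
    then have iK: "1 \<le> i + K" "i + K \<le> 2 * Suc n" "even (i + K) = even i" using K n by auto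
    show "1 \<le> \<tau> i \<and> \<tau> i \<le> 2*m"
      using hi[OF i(1)] hi'[OF i] \<tau>_eq[OF i(1)] by linarith
    show "\<tau> i < i" if "even i" using hi[OF i(1)] D(5)[OF iK(1,2)] iK(3) that \<tau>_eq[OF i(1)] by linarith
    show "i \<le> \<tau> i" if "odd i" using D(6)[OF iK(1,2)] iK(3) that \<tau>_eq[OF i(1)] by linarith
  next
    fix i assume "\<not> (1 \<le> i \<and> i \<le> 2*m)"
    then show "\<tau> i = i" using D(3)[of "i + K"] K n by (auto simp: \<tau>_def)
  next
    fix i j assume i: "1 \<le> i" "i < j" "j \<le> 2*m"
    then have "\<pi> (i + K) \<noteq> \<pi> (j + K)" "1 \<le> j" unfolding D(4) by auto
    then show "\<tau> i \<noteq> \<tau> j" using i(1) hi[of i] hi[of j] \<tau>_eq[of i] \<tau>_eq[of j] by linarith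
  next
    fix a b c d
    assume a: "1 \<le> a" "a < b" "b < c" "c < d" "d \<le> 2*m" "\<tau> b < \<tau> d" "\<tau> d < \<tau> a" "\<tau> a < \<tau> c"
    have "\<tau> a = \<pi> (a + K) - K" "\<tau> b = \<pi> (b + K) - K"
      "\<tau> c = \<pi> (c + K) - K" "\<tau> d = \<pi> (d + K) - K"
      by (rule \<tau>_eq; use a(1-5) in linarith)+
    with a(6-8) have v: "\<pi> (b + K) < \<pi> (d + K)" "\<pi> (d + K) < \<pi> (a + K)"
      "\<pi> (a + K) < \<pi> (c + K)" by linarith+
    have p: "1 \<le> a + K" "a + K < b + K" "b + K < c + K" "c + K < d + K" "d + K \<le> 2 * Suc n"
      using a(1-5) K n by simp_all
    show False using D(7)[OF p v(1,2)] v(3) by contradiction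
  qed
  ultimately show ?thesis using u k by (simp add: m_def)
qed

lemma glue_unglue:
  assumes "\<pi> \<in> dumont2_3142 (Suc n)"
  shows "glue (unglue \<pi>) = \<pi>"
proof
  fix x
  note B = dumont2_3142_block[OF assms]
  define k where "k = \<pi> 1 div 2 - 1"
  have K: "2 * k + 2 = \<pi> 1" using B(2,4) by (auto simp: k_def)
  have 0: "\<pi> 0 = 0" by (rule dumont2_3142D(3)[OF assms]) simp
  consider "x = 0" | "x = 1" | "x = 2" | "3 \<le> x" "x \<le> \<pi> 1" | "\<pi> 1 < x" "3 \<le> x" using B(2) by linarith
  then show "glue (unglue \<pi>) x = \<pi> x"
  proof cases
    case 4
    then have "2*k + 3 - x = \<pi> 1 + 1 - x" "\<pi> x \<le> \<pi> 1" using K B(5)[of x] by auto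
    moreover have "1 \<le> \<pi> 1 + 1 - x" "\<pi> 1 + 1 - x + 2 \<le> \<pi> 1" "\<pi> 1 + 1 - (\<pi> 1 + 1 - x) = x"
      using 4 by linarith+
    ultimately show ?thesis
      unfolding unglue_def glue_def prod.case k_def[symmetric] K using 4 by simp
  next
    case 5
    then show ?thesis
      unfolding unglue_def glue_def prod.case k_def[symmetric] K using B(6)[of x] by simp
  qed (use 0 B(1,2) in \<open>simp_all only: unglue_def glue_def prod.case k_def[symmetric] K, simp_all\<close>)
qed

section \<open>Fixed points and drops under gluing\<close>

text \<open>The positions are 1, 2, the reflected interval from 3 to \<open>K\<close> and the
  translated rest. An arbitrary predicate lets the count serve fixed points and drops alike.\<close>

lemma card_split_glue:
  assumes k: "k \<le> n"
  defines "K \<equiv> 2*k + 2"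
  shows "card {x\<in>{1..2 * Suc n}. P x} = of_bool (P 1) + of_bool (P 2)
    + card {i\<in>{1..2*k}. P (K + 1 - i)} + card {i\<in>{1..2*(n - k)}. P (i + K)}"
proof -
  let ?M = "{i\<in>{1..2*k}. P (K + 1 - i)}" and ?R = "{i\<in>{1..2*(n - k)}. P (i + K)}"
  have "{x\<in>{1..2 * Suc n}. P x}
      = {x\<in>{1, 2}. P x} \<union> ((\<lambda>i. K + 1 - i) ` ?M \<union> (\<lambda>i. i + K) ` ?R)" (is "?L = ?E")
  proof (intro set_eqI iffI)
    fix x assume x: "x \<in> ?L"
    then consider "x \<in> {1, 2}" | "3 \<le> x" "x \<le> K" | "K < x" by fastforce
    then show "x \<in> ?E"
    proof cases
      case 2
      define i where "i = K + 1 - x"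
      have i: "x = K + 1 - i" "i \<in> {1..2*k}" using 2 by (auto simp: i_def K_def)
      have "P x" using x by blast
      then have "i \<in> ?M" using i by blast
      then show ?thesis using i(1) by blast
    next
      case 3
      define i where "i = x - K"
      have i: "x = i + K" using 3 by (simp add: i_def)
      have "P x" "x \<le> 2 * Suc n" using x by simp_all
      then have "i \<in> ?R" using i 3 k by (simp add: K_def)
      then show ?thesis using i by blast
    qed (use x in auto)
  qed (use k in \<open>auto simp: K_def\<close>)
  moreover have "card {x\<in>{1, 2}. P x} = of_bool (P 1) + of_bool (P 2)"
    by (cases "P 1"; cases "P 2") (simp_all add: conj_disj_distribR Collect_disj_eq Collect_conv_if)
  moreover have "card ((\<lambda>i. K + 1 - i) ` ?M) = card ?M"
    by (intro card_image inj_onI) (auto simp: K_def)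
  moreover have "card ((\<lambda>i. i + K) ` ?R) = card ?R"
    by (intro card_image inj_onI) auto
  moreover have "(\<lambda>i. K + 1 - i) ` ?M \<inter> (\<lambda>i. i + K) ` ?R = {}" by (auto simp: K_def)
  moreover have "{x\<in>{1, 2}. P x} \<inter> ((\<lambda>i. K + 1 - i) ` ?M \<union> (\<lambda>i. i + K) ` ?R) = {}"
    by (auto simp: K_def)
  ultimately show ?thesis by (simp add: card_Un_disjoint)
qed

text \<open>In the reflected part, a position of the glued permutation and its mirror image in
  \<open>\<sigma>\<close> add up to \<open>K + 1\<close>, but their values add up to
  \<open>K\<close>; so fixed points and drops trade places. Position 2 with value 1 is the
  additional drop counted by \<open>Suc\<close>, and position 1 is neither a drop nor fixed.\<close>

lemma num_glue:
  assumes k: "k \<le> n" and \<sigma>: "\<sigma> \<in> dumont2_3142 k" and \<tau>: "\<tau> \<in> dumont2_3142 (n - k)"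
  shows "num_fixed_points (2 * Suc n) (glue (k, \<sigma>, \<tau>))
      = num_drops (2*k) \<sigma> + num_fixed_points (2*(n - k)) \<tau>"
    and "num_drops (2 * Suc n) (glue (k, \<sigma>, \<tau>))
      = Suc (num_fixed_points (2*k) \<sigma> + num_drops (2*(n - k)) \<tau>)"
proof -
  define K where "K = 2*k + 2"
  define g where "g = glue (k, \<sigma>, \<tau>)"
  have "K \<ge> 2" by (simp add: K_def)
  have g12: "g 1 = K" "g 2 = 1" by (simp_all add: g_def glue_def K_def)
  have mid: "g (K + 1 - i) + \<sigma> i = K" "K + 1 - i + i = K + 1" if i: "i \<in> {1..2*k}" for i
  proof -
    define x where "x = K + 1 - i"
    have "x \<le> K" "3 \<le> x" "2*k + 3 - x = i" using i by (auto simp: x_def K_def)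
    then have "g x = K - \<sigma> i" by (simp add: g_def glue_def K_def)
    moreover have "\<sigma> i \<le> K" using dumont2_3142D(2)[OF \<sigma>, of i] i by (simp add: K_def)
    ultimately show "g (K + 1 - i) + \<sigma> i = K" by (simp add: x_def)
    show "K + 1 - i + i = K + 1" using i by (simp add: K_def)
  qed
  have hi: "g (i + K) = \<tau> i + K" if "i \<in> {1..2*(n - k)}" for i
    using that by (simp add: g_def glue_def K_def)
  have fixed_iff: "z = y \<longleftrightarrow> s + 1 = i" and drop_iff: "z + 1 = y \<longleftrightarrow> s = i"
    if "z + s = K" "y + i = K + 1" for s i y z :: nat using that by linarith+
  have "{i\<in>{1..2*k}. g (K + 1 - i) = K + 1 - i} = {i\<in>{1..2*k}. \<sigma> i + 1 = i}"
    by (rule Collect_cong, rule conj_cong[OF refl], rule fixed_iff[OF mid])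
  moreover have "{i\<in>{1..2*(n - k)}. g (i + K) = i + K} = {i\<in>{1..2*(n - k)}. \<tau> i = i}"
    by (rule Collect_cong, rule conj_cong[OF refl]) (simp only: hi add_right_cancel)
  ultimately show "num_fixed_points (2 * Suc n) g
      = num_drops (2*k) \<sigma> + num_fixed_points (2*(n - k)) \<tau>"
    unfolding num_fixed_points_def num_drops_def
    unfolding card_split_glue[OF k, of "\<lambda>x. g x = x", folded K_def] g12
    using \<open>K \<ge> 2\<close> by (simp only: of_bool_def) simp
  have "{i\<in>{1..2*k}. g (K + 1 - i) + 1 = K + 1 - i} = {i\<in>{1..2*k}. \<sigma> i = i}"
    by (rule Collect_cong, rule conj_cong[OF refl], rule drop_iff[OF mid])
  moreover have "{i\<in>{1..2*(n - k)}. g (i + K) + 1 = i + K} = {i\<in>{1..2*(n - k)}. \<tau> i + 1 = i}"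
    by (rule Collect_cong, rule conj_cong[OF refl]) (simp add: hi)
  ultimately show "num_drops (2 * Suc n) g
      = Suc (num_fixed_points (2*k) \<sigma> + num_drops (2*(n - k)) \<tau>)"
    unfolding num_fixed_points_def num_drops_def
    unfolding card_split_glue[OF k, of "\<lambda>x. g x + 1 = x", folded K_def] g12
    using \<open>K \<ge> 2\<close> by (simp only: of_bool_def) simp
qed

section \<open>Generating functions of the permutations\<close>

lemma finite_dumont2_3142: "finite (dumont2_3142 n)"
proof (rule finite_subset)
  show "dumont2_3142 n \<subseteq> {\<pi>. \<pi> permutes {1..2*n}}" by (simp add: subset_iff dumont2_3142_iff)
qed (simp add: finite_permutations)

lemma sum_dumont2_3142_Suc:
  fixes f :: "(nat \<Rightarrow> nat) \<Rightarrow> 'a::comm_monoid_add"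
  shows "(\<Sum>\<pi>\<in>dumont2_3142 (Suc n). f \<pi>)
    = (\<Sum>k\<le>n. \<Sum>\<sigma>\<in>dumont2_3142 k. \<Sum>\<tau>\<in>dumont2_3142 (n - k). f (glue (k, \<sigma>, \<tau>)))"
proof -
  have "(\<Sum>\<pi>\<in>dumont2_3142 (Suc n). f \<pi>)
      = (\<Sum>x\<in>(SIGMA k:{..n}. dumont2_3142 k \<times> dumont2_3142 (n - k)). f (glue x))"
  proof (rule sum.reindex_bij_witness[where i = glue and j = unglue])
    fix \<pi> assume \<pi>: "\<pi> \<in> dumont2_3142 (Suc n)"
    show "glue (unglue \<pi>) = \<pi>" by (rule glue_unglue[OF \<pi>])
    then show "f (glue (unglue \<pi>)) = f \<pi>" by simp
    show "unglue \<pi> \<in> (SIGMA k:{..n}. dumont2_3142 k \<times> dumont2_3142 (n - k))"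
      by (rule unglue_in_dumont2_3142[OF \<pi>])
  next
    fix x assume "x \<in> (SIGMA k:{..n}. dumont2_3142 k \<times> dumont2_3142 (n - k))"
    then obtain k \<sigma> \<tau> where x: "x = (k, \<sigma>, \<tau>)" "k \<le> n" "\<sigma> \<in> dumont2_3142 k" "\<tau> \<in> dumont2_3142 (n - k)"
      by blast
    show "unglue (glue x) = x" "glue x \<in> dumont2_3142 (Suc n)"
      unfolding x(1) by (rule unglue_glue[OF x(2-4)], rule glue_in_dumont2_3142[OF x(2-4)])
  qed
  then show ?thesis
    by (simp add: sum.Sigma sum.cartesian_product finite_dumont2_3142)
qed

definition fix_sum :: "'a::comm_semiring_1 \<Rightarrow> nat \<Rightarrow> 'a" where
  "fix_sum q n = (\<Sum>\<pi>\<in>dumont2_3142 n. q ^ num_fixed_points (2*n) \<pi>)"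

definition drop_sum :: "'a::comm_semiring_1 \<Rightarrow> nat \<Rightarrow> 'a" where
  "drop_sum q n = (\<Sum>\<pi>\<in>dumont2_3142 n. q ^ num_drops (2*n) \<pi>)"

lemma fix_sum_Suc: "fix_sum q (Suc n) = (\<Sum>k\<le>n. drop_sum q k * fix_sum q (n - k))"
  unfolding fix_sum_def drop_sum_def sum_dumont2_3142_Suc sum_product
  by (intro sum.cong refl) (simp only: atMost_iff num_glue(1) power_add)

lemma drop_sum_Suc: "drop_sum q (Suc n) = q * (\<Sum>k\<le>n. fix_sum q k * drop_sum q (n - k))"
  unfolding fix_sum_def drop_sum_def sum_dumont2_3142_Suc sum_product
  unfolding sum_distrib_left
  by (intro sum.cong refl) (simp only: atMost_iff num_glue(2) power_add power_Suc)

lemma dumont2_3142_0: "dumont2_3142 0 = {\<lambda>x. x}"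
  by (auto simp: dumont2_3142_iff id_def)

lemma fix_sum_0: "fix_sum q 0 = 1" and drop_sum_0: "drop_sum q 0 = 1"
  by (simp_all add: fix_sum_def drop_sum_def dumont2_3142_0 num_fixed_points_def num_drops_def)

text \<open>The product \<open>x H F\<close> occurs in the equations of both \<open>F\<close> and
  \<open>H\<close>, so replacing it by \<open>F - 1\<close> in the latter eliminates
  \<open>H\<close>.\<close>

lemma fix_sum_equation:
  fixes q :: "'a::comm_ring_1"
  defines "F \<equiv> Abs_fps (fix_sum q)"
  shows "F = 1 + fps_X * F * (1 + fps_const q * (F - 1))"
proof -
  define H where "H = Abs_fps (drop_sum q)"
  have F: "F = 1 + fps_X * (H * F)"
    using fps_eq_if_convolution[of "fix_sum q" "drop_sum q" "fix_sum q", OF fix_sum_Suc] by (simp add: F_def H_def fix_sum_0)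
  have "drop_sum q (Suc n) = (\<Sum>k\<le>n. (q * fix_sum q k) * drop_sum q (n - k))" for n
    by (simp only: drop_sum_Suc sum_distrib_left mult.assoc)
  then have "H = 1 + fps_X * (Abs_fps (\<lambda>n. q * fix_sum q n) * H)"
    using fps_eq_if_convolution[of "drop_sum q" "\<lambda>n. q * fix_sum q n" "drop_sum q"]
    by (simp only: H_def drop_sum_0 fps_const_1_eq_1)
  also have "Abs_fps (\<lambda>n. q * fix_sum q n) = fps_const q * F"
    by (simp add: F_def fps_eq_iff)
  also have "fps_X * (fps_const q * F * H) = fps_const q * (fps_X * (H * F))"
    by (simp only: mult_ac)
  also have "fps_X * (H * F) = F - 1" using F by (metis add_diff_cancel_left')
  finally have "H = 1 + fps_const q * (F - 1)" .
  then show ?thesis using F by (metis mult.assoc mult.commute)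
qed

section \<open>Noncrossing partitions\<close>

text \<open>An arbitrary ground set is allowed because the right-hand part of a split partition
  lives on \<open>{j + 1..n}\<close>.\<close>

definition nc :: "nat set \<Rightarrow> nat set set set" where
  "nc A = {P. partition_on A P \<and> noncrossing P}"

lemma noncrossingD:
  assumes "noncrossing P" "B \<in> P" "C \<in> P" "a \<in> B" "c \<in> B" "b \<in> C" "d \<in> C" "a < b" "b < c" "c < d"
  shows "B = C"
  using assms unfolding noncrossing_def by blast

text \<open>A crossing of two blocks is also a crossing of the larger blocks that contain them. This
  transfers the property to the two parts of a split partition, where one block has lost
  \<open>n + 1\<close>.\<close>

lemma noncrossing_refine:
  assumes "noncrossing P" "inj_on f Q" "\<And>B. B \<in> Q \<Longrightarrow> B \<subseteq> f B \<and> f B \<in> P"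
  shows "noncrossing Q"
  unfolding noncrossing_def
proof clarify
  fix a b c d B C
  assume *: "B \<in> Q" "C \<in> Q" "a < b" "b < c" "c < d" "B \<noteq> C" "a \<in> B" "c \<in> B" "b \<in> C" "d \<in> C"
  then have "f B = f C"
    using assms(3)[of B] assms(3)[of C] by (intro noncrossingD[OF assms(1), of _ _ a c b d]) auto
  then show False using * assms(2) by (auto dest: inj_onD)
qed

lemma nc_block_eq:
  assumes "P \<in> nc A" "B \<in> P" "C \<in> P" "x \<in> B" "x \<in> C"
  shows "B = C"
  using assms by (auto simp: nc_def partition_on_def dest: disjointD)

lemma nc_Union: "P \<in> nc A \<Longrightarrow> \<Union>P = A"
  by (simp add: nc_def partition_on_def)

lemma nc_nonempty: "P \<in> nc A \<Longrightarrow> {} \<notin> P"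
  by (simp add: nc_def partition_on_def)

lemma ncI:
  assumes "\<Union>P = A" "{} \<notin> P" "\<And>B C x. B \<in> P \<Longrightarrow> C \<in> P \<Longrightarrow> x \<in> B \<Longrightarrow> x \<in> C \<Longrightarrow> B = C"
    and "noncrossing P"
  shows "P \<in> nc A"
  using assms by (auto simp: nc_def partition_on_def disjoint_def)

lemma finite_nc: "finite A \<Longrightarrow> finite (nc A)"
  unfolding nc_def by (rule finite_subset[OF _ finitely_many_partition_on]) auto

lemma finite_nc_elem: "finite A \<Longrightarrow> P \<in> nc A \<Longrightarrow> finite P"
  unfolding nc_def by (auto intro: finite_elements)

text \<open>Choosing one element from each block is injective. The bound guarantees that exponents
  such as \<open>n - card P\<close> are not truncated.\<close>

lemma card_nc_le: "finite A \<Longrightarrow> P \<in> nc A \<Longrightarrow> card P \<le> card A"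
proof -
  assume A: "finite A" and P: "P \<in> nc A"
  have "\<exists>x. x \<in> B" if "B \<in> P" for B using that nc_nonempty[OF P] by (metis all_not_in_conv)
  then obtain f where f: "\<And>B. B \<in> P \<Longrightarrow> f B \<in> B" by metis
  have "inj_on f P" using f nc_block_eq[OF P] by (metis inj_onI)
  moreover have "f ` P \<subseteq> A" using f nc_Union[OF P] by blast
  ultimately show "card P \<le> card A" using A by (rule card_inj_on_le)
qed

lemma nc_image:
  assumes "strict_mono_on A f" "P \<in> nc A"
  shows "(`) f ` P \<in> nc (f ` A)"
proof -
  note U = nc_Union[OF assms(2)]
  have inj: "inj_on f A" using assms(1) by (rule strict_mono_on_imp_inj_on)
  have less: "x < y \<longleftrightarrow> f x < f y" if "x \<in> A" "y \<in> A" for x y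
    using strict_mono_on_less[OF assms(1)] that by auto
  show ?thesis
  proof (rule ncI)
    show "\<Union> ((`) f ` P) = f ` A" using U by auto
    show "{} \<notin> (`) f ` P" using nc_nonempty[OF assms(2)] by auto
    show "B = C" if BC: "B \<in> (`) f ` P" "C \<in> (`) f ` P" and x: "x \<in> B" "x \<in> C" for B C x
    proof -
      obtain B' C' where *: "B = f ` B'" "C = f ` C'" "B' \<in> P" "C' \<in> P" using BC by auto
      obtain y where y: "x = f y" "y \<in> B'" using x(1) * by blast
      obtain z where z: "x = f z" "z \<in> C'" using x(2) * by blast
      note yz = y z
      have "y \<in> A" "z \<in> A" using yz * U by blast+
      then have "y = z" using inj_onD[OF inj, of y z] yz by simp
      then show ?thesis using nc_block_eq[OF assms(2), of B' C' y] yz * by simp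
    qed
    show "noncrossing ((`) f ` P)"
      unfolding noncrossing_def
    proof clarify
      fix a b c d B C
      assume *: "B \<in> P" "C \<in> P" "f ` B \<noteq> f ` C" "a \<in> B" "c \<in> B" "b \<in> C" "d \<in> C"
        "f a < f b" "f b < f c" "f c < f d"
      then have "a \<in> A" "b \<in> A" "c \<in> A" "d \<in> A" using U by blast+
      then have "B = C" using * assms(2) less
        by (intro noncrossingD[of P B C a c b d]) (auto simp: nc_def)
      then show False using * by simp
    qed
  qed
qed

text \<open>Translation preserves order, hence crossings and the number of blocks; this reduces the
  right-hand part to an initial interval.\<close>

lemma sum_nc_translate:
  fixes h :: "nat \<Rightarrow> 'a::comm_monoid_add"
  shows "(\<Sum>P\<in>nc {j + 1..j + m}. h (card P)) = (\<Sum>P\<in>nc {1..m}. h (card P))"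
proof -
  define f where "f = (\<lambda>x::nat. x + j)"
  define g where "g = (\<lambda>x::nat. x - j)"
  have fA: "f ` {1..m} = {j + 1..j + m}" by (simp add: f_def add.commute)
  have gA: "g ` {j + 1..j + m} = {1..m}"
    unfolding fA[symmetric] image_image by (simp add: f_def g_def)
  have f: "strict_mono_on {1..m} f" by (auto simp: f_def strict_mono_on_def)
  have g: "strict_mono_on {j + 1..j + m} g" by (auto simp: g_def strict_mono_on_def)
  have gf: "(`) g ` (`) f ` P = P" for P by (simp add: image_image f_def g_def)
  have fg: "(`) f ` (`) g ` P = P" if P: "P \<in> nc {j + 1..j + m}" for P
  proof -
    have "f ` g ` B = B" if "B \<in> P" for B
    proof -
      have "f (g x) = x" if "x \<in> B" for x
      proof -
        have "x \<in> {j + 1..j + m}" using that \<open>B \<in> P\<close> nc_Union[OF P] by blast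
        then show ?thesis by (simp add: f_def g_def)
      qed
      then show ?thesis by (simp add: image_image)
    qed
    then show ?thesis by (simp add: image_image)
  qed
  show ?thesis
  proof (rule sum.reindex_bij_witness[where i = "\<lambda>P. (`) f ` P" and j = "\<lambda>P. (`) g ` P"])
    fix P assume P: "P \<in> nc {j + 1..j + m}"
    show "(`) g ` P \<in> nc {1..m}" using nc_image[OF g P] gA by simp
    show "(`) f ` (`) g ` P = P" by (rule fg[OF P])
    have "inj f" by (simp add: f_def inj_on_def)
    then have "card ((`) f ` (`) g ` P) = card ((`) g ` P)"
      by (intro card_image inj_onI) (simp add: inj_image_eq_iff)
    then show "h (card ((`) g ` P)) = h (card P)" by (simp only: fg[OF P])
  next
    fix P assume P: "P \<in> nc {1..m}"
    show "(`) f ` P \<in> nc {j + 1..j + m}" using nc_image[OF f P] fA by simp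
    show "(`) g ` (`) f ` P = P" by (rule gf)
  qed
qed

text \<open>
  \<open>j\<close> is the predecessor of \<open>n + 1\<close> in its block, and \<open>j = 0\<close> means that \<open>{n + 1}\<close> is a block; then
  \<open>C\<close> is the empty set.
\<close>
definition attach :: "nat \<Rightarrow> nat \<times> nat set set \<times> nat set set \<Rightarrow> nat set set" where
  "attach n = (\<lambda>(j, P, Q). let C = \<Union>{B\<in>P. j \<in> B} in insert (insert (n + 1) C) (P - {C}) \<union> Q)"

text \<open>The inserted 0 gives \<open>j = 0\<close> when \<open>n + 1\<close> is alone in its
  block, and subtracting \<open>{{}}\<close> keeps the then empty \<open>C\<close> from becoming a
  block.\<close>

definition detach :: "nat \<Rightarrow> nat set set \<Rightarrow> nat \<times> nat set set \<times> nat set set" where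
  "detach n R = (let C = \<Union>{B\<in>R. n + 1 \<in> B} - {n + 1}; j = Max (insert 0 C) in
     (j, {B\<in>R. B \<subseteq> {1..j}} \<union> ({C} - {{}}), {B\<in>R. B \<subseteq> {j + 1..n}}))"

section \<open>Splitting at the predecessor of the largest element\<close>

lemma Union_block:
  assumes "P \<in> nc A" "B \<in> P" "x \<in> B"
  shows "\<Union>{B\<in>P. x \<in> B} = B"
  using assms nc_block_eq[OF assms(1)] by blast

lemma attach_block:
  assumes P: "P \<in> nc {1..j}"
  defines "C \<equiv> \<Union>{B\<in>P. j \<in> B}"
  shows "C \<subseteq> {1..j}" "j = 0 \<Longrightarrow> C = {} \<and> P = {}" "j > 0 \<Longrightarrow> C \<in> P \<and> j \<in> C"
proof -
  show "C \<subseteq> {1..j}" using nc_Union[OF P] by (auto simp: C_def)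
  show "j = 0 \<Longrightarrow> C = {} \<and> P = {}" using P by (simp add: C_def nc_def partition_on_empty)
  assume "j > 0"
  then have "j \<in> \<Union>P" using nc_Union[OF P] by auto
  then obtain B where B: "B \<in> P" "j \<in> B" by blast
  then show "C \<in> P \<and> j \<in> C" using Union_block[OF P B] by (simp add: C_def)
qed

text \<open>Without \<open>n + 1\<close>, the enlarged block is \<open>C\<close>, and the blocks of
  \<open>P\<close> and \<open>Q\<close> lie in disjoint consecutive intervals. So only a crossing
  with last element \<open>n + 1\<close> is new, and there \<open>j\<close>, the largest element of
  \<open>C\<close>, can stand in for \<open>n + 1\<close>.\<close>

lemma attach_in_nc:
  assumes "j \<le> n" and P: "P \<in> nc {1..j}" and Q: "Q \<in> nc {j + 1..n}"
  shows "attach n (j, P, Q) \<in> nc {1..n + 1}"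
proof -
  define C where "C = \<Union>{B\<in>P. j \<in> B}"
  note C = C_def[symmetric] attach_block[OF P, folded C_def]
  define B0 where "B0 = insert (n + 1) C"
  have R: "attach n (j, P, Q) = insert B0 (P - {C}) \<union> Q"
    by (simp add: attach_def C(1) B0_def)
  have PB: "B \<subseteq> {1..j}" if "B \<in> P" for B using that nc_Union[OF P] by blast
  have QB: "B \<subseteq> {j + 1..n}" if "B \<in> Q" for B using that nc_Union[OF Q] by blast
  have PC: "B = C" if "B \<in> P" "x \<in> B" "x \<in> C" for B x
    using C(3,4) that nc_block_eq[OF P, of B C x] by (cases "j = 0") auto
  have PQ: "x \<notin> B'" if "B \<in> P" "x \<in> B" "B' \<in> Q" for B B' x
    using PB[OF that(1)] QB[OF that(3)] that(2) by fastforce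
  have CQ: "x \<notin> B'" if "x \<in> C" "B' \<in> Q" for B' x
    using C(2) QB[OF that(2)] that(1) by fastforce
  have n1: "n + 1 \<notin> B" if "B \<in> P \<union> Q" for B
    using that PB[of B] QB[of B] \<open>j \<le> n\<close> by fastforce
  show ?thesis
    unfolding R
  proof (rule ncI)
    have "\<Union>(P - {C}) \<union> C = {1..j}"
    proof (cases "j = 0")
      case False
      then have "insert C (P - {C}) = P" using C(4) by blast
      then show ?thesis using nc_Union[OF P] by (metis Un_commute Union_insert)
    qed (use C in simp)
    then have "\<Union>(insert B0 (P - {C}) \<union> Q) = insert (n + 1) ({1..j} \<union> {j + 1..n})"
      using nc_Union[OF Q] unfolding B0_def by blast
    also have "\<dots> = {1..n + 1}" using \<open>j \<le> n\<close> by auto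
    finally show "\<Union>(insert B0 (P - {C}) \<union> Q) = {1..n + 1}" .
    show "{} \<notin> insert B0 (P - {C}) \<union> Q" using nc_nonempty[OF P] nc_nonempty[OF Q] by (auto simp: B0_def)
    have B0: "B = B0" if "B \<in> insert B0 (P - {C}) \<union> Q" "x \<in> B" "x \<in> B0" for B x
      using that PC[of B x] CQ[of x B] n1[of B] by (auto simp: B0_def)
    fix B B' x
    assume *: "B \<in> insert B0 (P - {C}) \<union> Q" "B' \<in> insert B0 (P - {C}) \<union> Q" "x \<in> B" "x \<in> B'"
    consider "B = B0" | "B' = B0" | "B \<in> P" "B' \<in> P" | "B \<in> Q" "B' \<in> Q"
      | "B \<in> P" "B' \<in> Q" | "B' \<in> P" "B \<in> Q" using * by blast
    then show "B = B'"
    proof cases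
      case 1 then show ?thesis using B0[of B' x] * by simp
    next
      case 2 then show ?thesis using B0[of B x] * by simp
    next
      case 3 then show ?thesis using nc_block_eq[OF P] * by simp
    next
      case 4 then show ?thesis using nc_block_eq[OF Q] * by simp
    qed (use PQ * in blast)+
  next
    have ncP: "noncrossing P" "noncrossing Q" using P Q by (auto simp: nc_def)
    have PQ: "B = B'" if *: "B \<in> P \<union> Q" "B' \<in> P \<union> Q" "a \<in> B" "c \<in> B" "b \<in> B'" "d \<in> B'" "a < b" "b < c" "c < d"
      for B B' a b c d
    proof -
      consider "B \<in> P" "B' \<in> P" | "B \<in> Q" "B' \<in> Q" | "B \<in> P" "B' \<in> Q" | "B \<in> Q" "B' \<in> P" using * by blast
      then show ?thesis
      proof cases
        case 1 then show ?thesis using noncrossingD[OF ncP(1)] * by blast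
      next
        case 2 then show ?thesis using noncrossingD[OF ncP(2)] * by blast
      next
        case 3
        then have "c \<le> j" "j < b" using PB[of B] QB[of B'] * by fastforce+
        then show ?thesis using * by linarith
      next
        case 4
        then have "d \<le> j" "j < a" using PB[of B'] QB[of B] * by fastforce+
        then show ?thesis using * by linarith
      qed
    qed
    show "noncrossing (insert B0 (P - {C}) \<union> Q)"
      unfolding noncrossing_def
    proof clarify
      fix a b c d B B'
      assume B: "B \<in> insert B0 (P - {C}) \<union> Q" and B': "B' \<in> insert B0 (P - {C}) \<union> Q"
        and *: "a < b" "b < c" "c < d" "B \<noteq> B'" "a \<in> B" "c \<in> B" "b \<in> B'" "d \<in> B'"
      have bound: "x \<le> n + 1" if "x \<in> X" "X \<in> insert B0 (P - {C}) \<union> Q" for x X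
        using that PB[of X] QB[of X] C(2) \<open>j \<le> n\<close> by (fastforce simp: B0_def)
      \<comment> \<open>Undoing the enlargement moves the points below \<open>n + 1\<close> back
        into blocks of \<open>P\<close> and \<open>Q\<close>.\<close>
      define u where "u X = (if X = B0 then C else X)" for X
      have u: "x \<in> u X" "u X \<in> P \<union> Q" if "x \<in> X" "X \<in> insert B0 (P - {C}) \<union> Q" "x < n + 1" for x X
      proof -
        show x: "x \<in> u X" using that by (auto simp: u_def B0_def)
        have "j > 0" if "X = B0" using x that C(2) by (auto simp: u_def)
        then show "u X \<in> P \<union> Q" using that(2) C(4) by (auto simp: u_def)
      qed
      have c: "c < n + 1" using bound[OF \<open>d \<in> B'\<close> B'] * by linarith
      have uB: "a \<in> u B" "c \<in> u B" "u B \<in> P \<union> Q" "b \<in> u B'" "u B' \<in> P \<union> Q"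
        using u[OF \<open>a \<in> B\<close> B] u[OF \<open>c \<in> B\<close> B] u[OF \<open>b \<in> B'\<close> B'] c * by auto
      have "u B = u B'"
      proof (cases "d = n + 1")
        case False
        then have "d < n + 1" using bound[OF \<open>d \<in> B'\<close> B'] by simp
        then show ?thesis using PQ[OF uB(3,5,1,2,4)] u(1)[OF \<open>d \<in> B'\<close> B'] * by blast
      next
        case True
        then have B'0: "B' = B0" using n1[of B'] * B' by blast
        then have "u B' = C" by (simp add: u_def)
        with uB(4) have bj: "b \<in> C" "j > 0" "b \<le> j" using C(2) by auto
        then have jC: "C \<in> P" "j \<in> C" using C(4) by auto
        show ?thesis
        \<comment> \<open>If \<open>c < j\<close>, then \<open>a < b < c < j\<close> is a crossing
          before the enlargement. Otherwise \<open>c = j\<close>, and the two blocks share an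
          element.\<close>
        proof (cases "c < j")
          case True
          show ?thesis
            using PQ[OF uB(3,5,1,2,4)] True jC * \<open>u B' = C\<close> by blast
        next
          case False
          have "u B \<in> P"
          proof (rule ccontr)
            assume "u B \<notin> P"
            then have "a > j" using uB QB[of "u B"] by fastforce
            then show False using bj * by linarith
          qed
          then have "c = j" using PB[of "u B"] uB(2) False by fastforce
          then show ?thesis using PC[OF \<open>u B \<in> P\<close>, of j] uB(2) jC \<open>u B' = C\<close> by simp
        qed
      qed
      \<comment> \<open>Distinct blocks have the same image under \<open>u\<close> only if one is
        \<open>B0\<close> and the other is \<open>C\<close>; but \<open>C\<close> was removed from
        \<open>P\<close>, and no block of \<open>Q\<close> meets it.\<close>
      then have "B \<in> P - {C} \<and> B' = B0 \<and> B = C \<or> B = B0 \<and> B' = C \<and> B' \<in> P - {C} \<union> Q \<or> B = C \<and> B \<in> Q"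
        using B B' * by (auto simp: u_def split: if_splits)
      then show False
        using CQ uB by (metis B B' DiffD2 UnE \<open>u B = u B'\<close> insertCI insert_Diff_single singletonI u_def)
    qed
  qed
qed

lemma Union_block_attach:
  assumes "j \<le> n" and P: "P \<in> nc {1..j}" and Q: "Q \<in> nc {j + 1..n}"
  shows "\<Union>{B\<in>attach n (j, P, Q). n + 1 \<in> B} = insert (n + 1) (\<Union>{B\<in>P. j \<in> B})"
  by (rule Union_block[OF attach_in_nc[OF assms]]) (simp_all add: attach_def Let_def)

text \<open>The number \<open>j\<close> is recovered as the largest element of \<open>C\<close>.
  Blocks are nonempty, so the interval containing a block tells \<open>P\<close> from
  \<open>Q\<close>, and the block of \<open>n + 1\<close> fits into neither interval.\<close>

lemma detach_attach:
  assumes "j \<le> n" and P: "P \<in> nc {1..j}" and Q: "Q \<in> nc {j + 1..n}"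
  shows "detach n (attach n (j, P, Q)) = (j, P, Q)"
proof -
  define C where "C = \<Union>{B\<in>P. j \<in> B}"
  note C = C_def[symmetric] attach_block[OF P, folded C_def]
  have PB: "B \<subseteq> {1..j}" if "B \<in> P" for B using that nc_Union[OF P] by blast
  have QB: "B \<subseteq> {j + 1..n}" if "B \<in> Q" for B using that nc_Union[OF Q] by blast
  have n1: "insert (n + 1) C - {n + 1} = C" using C(2) \<open>j \<le> n\<close> by auto
  have j: "Max (insert 0 C) = j"
  proof (cases "j = 0")
    case False
    then show ?thesis using C(2,4) by (intro Max_eqI) (auto intro: finite_subset)
  qed (use C(3) in simp)
  have R: "attach n (j, P, Q) = insert (insert (n + 1) C) (P - {C}) \<union> Q"
    by (simp add: attach_def C(1))
  have sep: "\<not> B \<subseteq> {1..j}" if "B \<in> Q" for B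
  proof -
    have "B \<noteq> {}" using nc_nonempty[OF Q] that by metis
    then obtain x where "x \<in> B" by blast
    then show ?thesis using QB[OF that] by fastforce
  qed
  have sep': "\<not> B \<subseteq> {j + 1..n}" if "B \<in> P" for B
  proof -
    have "B \<noteq> {}" using nc_nonempty[OF P] that by metis
    then obtain x where "x \<in> B" by blast
    then show ?thesis using PB[OF that] by fastforce
  qed
  have big: "\<not> insert (n + 1) C \<subseteq> {1..j}" "\<not> insert (n + 1) C \<subseteq> {j + 1..n}"
    using \<open>j \<le> n\<close> by auto
  have "{B \<in> attach n (j, P, Q). B \<subseteq> {1..j}} = P - {C}"
    unfolding R using big PB sep by blast
  moreover have "P - {C} \<union> ({C} - {{}}) = P"
    using C(3,4) nc_nonempty[OF P] by (cases "j = 0") auto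
  moreover have "{B \<in> attach n (j, P, Q). B \<subseteq> {j + 1..n}} = Q"
    unfolding R using big QB sep' by blast
  ultimately show ?thesis
    unfolding detach_def Let_def Union_block_attach[OF assms] C(1) n1 j by simp
qed

text \<open>The enlarged block replaces the block \<open>C\<close> of \<open>P\<close>, except for
  \<open>j = 0\<close>, when it is a new singleton.\<close>

lemma card_attach:
  assumes "j \<le> n" and P: "P \<in> nc {1..j}" and Q: "Q \<in> nc {j + 1..n}"
  shows "card (attach n (j, P, Q)) = card P + card Q + of_bool (j = 0)"
proof -
  define C where "C = \<Union>{B\<in>P. j \<in> B}"
  note C = C_def[symmetric] attach_block[OF P, folded C_def]
  have PB: "B \<subseteq> {1..j}" if "B \<in> P" for B using that nc_Union[OF P] by blast
  have QB: "B \<subseteq> {j + 1..n}" if "B \<in> Q" for B using that nc_Union[OF Q] by blast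
  have fin: "finite P" "finite Q" using finite_nc_elem P Q by blast+
  have R: "attach n (j, P, Q) = insert (insert (n + 1) C) ((P - {C}) \<union> Q)"
    by (simp add: attach_def C(1))
  have "insert (n + 1) C \<notin> (P - {C}) \<union> Q" using PB QB \<open>j \<le> n\<close> by fastforce
  then have "card (attach n (j, P, Q)) = Suc (card ((P - {C}) \<union> Q))"
    unfolding R using fin by simp
  also have "(P - {C}) \<inter> Q = {}"
  proof -
    have "B \<notin> Q" if "B \<in> P" for B
    proof -
      have "B \<noteq> {}" using nc_nonempty[OF P] that by metis
      then obtain x where "x \<in> B" by blast
      then show ?thesis using PB[OF that] QB[of B] by fastforce
    qed
    then show ?thesis by blast
  qed
  then have "card ((P - {C}) \<union> Q) = card (P - {C}) + card Q"
    using fin by (simp add: card_Un_disjoint)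
  also have "Suc (card (P - {C}) + card Q) = card P + card Q + of_bool (j = 0)"
  proof (cases "j = 0")
    case False
    then have "card P > 0" using C(4) fin by (auto simp: card_gt_0_iff)
    then show ?thesis using False C(4) by simp
  qed (use C(3) in simp)
  finally show ?thesis .
qed

text \<open>A block other than that of \<open>n + 1\<close> with elements on both sides of
  \<open>j\<close> would cross it at \<open>j\<close> and \<open>n + 1\<close>. Hence every other
  block lies within one of the two intervals.\<close>

lemma nc_detach:
  assumes R: "R \<in> nc {1..n + 1}"
  obtains j P Q where "detach n R = (j, P, Q)" "j \<le> n" "P \<in> nc {1..j}" "Q \<in> nc {j + 1..n}"
    "attach n (j, P, Q) = R"
proof -
  have "n + 1 \<in> \<Union>R" using nc_Union[OF R] by simp
  then obtain B0 where B0: "B0 \<in> R" "n + 1 \<in> B0" by blast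
  define C where "C = B0 - {n + 1}"
  define j where "j = Max (insert 0 C)"
  define P where "P = {B\<in>R. B \<subseteq> {1..j}} \<union> ({C} - {{}})"
  define Q where "Q = {B\<in>R. B \<subseteq> {j + 1..n}}"
  have det: "detach n R = (j, P, Q)"
    unfolding detach_def Let_def Union_block[OF R B0] P_def Q_def j_def C_def by simp
  have RB: "B \<subseteq> {1..n + 1}" if "B \<in> R" for B using that nc_Union[OF R] by blast
  have C_sub: "C \<subseteq> {1..n}"
  proof
    fix x assume "x \<in> C"
    then show "x \<in> {1..n}" using RB[OF B0(1)] by (cases "x = n + 1") (auto simp: C_def)
  qed
  then have finC: "finite C" by (rule finite_subset) simp
  have Cj: "C \<subseteq> {1..j}"
  proof
    fix x assume "x \<in> C"
    then show "x \<in> {1..j}" using C_sub finC by (auto simp: j_def)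
  qed
  have jn: "j \<le> n" using finC C_sub by (auto simp: j_def)
  have j0: "j \<in> C" if "j > 0"
    using Max_in[of "insert 0 C"] finC that by (auto simp: j_def)
  have C0: "j > 0" if "C \<noteq> {}" using that Cj by fastforce
  have B0_eq: "B0 = insert (n + 1) C" using B0(2) by (auto simp: C_def)
  have split: "B \<subseteq> {1..j} \<or> B \<subseteq> {j + 1..n}" if B: "B \<in> R" "B \<noteq> B0" for B
  proof (rule ccontr)
    assume "\<not> ?thesis"
    then obtain x y where xy: "x \<in> B" "x \<notin> {1..j}" "y \<in> B" "y \<notin> {j + 1..n}" by blast
    have n1: "n + 1 \<notin> B" using nc_block_eq[OF R B(1) B0(1) _ B0(2)] B(2) by blast
    then have "x \<noteq> n + 1" "y \<noteq> n + 1" using xy by blast+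
    then have *: "j < x" "x < n + 1" "1 \<le> y" "y \<le> j" using xy RB[OF B(1)] by fastforce+
    then have jC: "j \<in> B0" using j0 by (auto simp: C_def)
    then have "y \<noteq> j" using nc_block_eq[OF R B(1) B0(1)] xy(3) B(2) by blast
    then have "B = B0" using R * xy jC B0 B
      by (intro noncrossingD[of R B B0 y x j "n + 1"]) (auto simp: nc_def)
    then show False using B(2) by simp
  qed
  have Rsplit: "R = insert B0 {B\<in>R. B \<subseteq> {1..j}} \<union> Q"
    using split B0(1) by (auto simp: Q_def)
  have B0_not: "\<not> B0 \<subseteq> {1..j}" "\<not> B0 \<subseteq> {j + 1..n}" using B0(2) jn by auto
  have blocks: "B = B'" if "B \<in> R" "B' \<in> R" "x \<in> B" "x \<in> B'" for B B' x
    using nc_block_eq[OF R] that by blast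
  have C_disj: "x \<notin> B" if "B \<in> R" "B \<subseteq> {1..j} \<or> B \<subseteq> {j + 1..n}" "x \<in> C" for B x
    using blocks[OF that(1) B0(1), of x] that B0_not by (auto simp: C_def)
  have cover: "\<exists>B\<in>R. x \<in> B \<and> (B = B0 \<or> B \<subseteq> {1..j} \<or> B \<subseteq> {j + 1..n})" if "1 \<le> x" "x \<le> n" for x
  proof -
    have "x \<in> \<Union>R" using that nc_Union[OF R] by simp
    then show ?thesis using split by blast
  qed
  have ncR: "noncrossing R" using R by (simp add: nc_def)
  have P: "P \<in> nc {1..j}"
  proof (rule ncI)
    show "\<Union>P = {1..j}"
    proof
      show "\<Union>P \<subseteq> {1..j}" using Cj by (auto simp: P_def)
      show "{1..j} \<subseteq> \<Union>P"
      proof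
        fix x assume x: "x \<in> {1..j}"
        then obtain B where B: "B \<in> R" "x \<in> B" "B = B0 \<or> B \<subseteq> {1..j} \<or> B \<subseteq> {j + 1..n}"
          using cover[of x] jn by auto
        have "\<not> B \<subseteq> {j + 1..n}" using B(2) x by fastforce
        moreover have "x \<in> C" if "B = B0" using that B(2) x jn by (simp add: C_def)
        ultimately show "x \<in> \<Union>P" using B unfolding P_def by blast
      qed
    qed
    show "{} \<notin> P" using nc_nonempty[OF R] by (simp add: P_def)
    show "B = B'" if "B \<in> P" "B' \<in> P" "x \<in> B" "x \<in> B'" for B B' x
      using that blocks C_disj unfolding P_def by blast
    show "noncrossing P"
    \<comment> \<open>Each block of \<open>P\<close> is a block of \<open>R\<close>, except for
      \<open>C\<close>, which is contained in \<open>B0\<close>.\<close>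
    proof (rule noncrossing_refine[OF ncR])
      show "inj_on (\<lambda>B. if B = C then B0 else B) P"
        using B0_not by (auto simp: inj_on_def P_def)
      show "B \<subseteq> (if B = C then B0 else B) \<and> (if B = C then B0 else B) \<in> R" if "B \<in> P" for B
        using that B0(1) by (auto simp: P_def C_def)
    qed
  qed
  have Q: "Q \<in> nc {j + 1..n}"
  proof (rule ncI)
    show "\<Union>Q = {j + 1..n}"
    proof
      show "\<Union>Q \<subseteq> {j + 1..n}" by (auto simp: Q_def)
      show "{j + 1..n} \<subseteq> \<Union>Q"
      proof
        fix x assume x: "x \<in> {j + 1..n}"
        then obtain B where B: "B \<in> R" "x \<in> B" "B = B0 \<or> B \<subseteq> {1..j} \<or> B \<subseteq> {j + 1..n}"
          using cover[of x] by auto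
        have "\<not> B \<subseteq> {1..j}" using B(2) x by fastforce
        moreover have "B \<noteq> B0" using B(2) x Cj by (auto simp: B0_eq)
        ultimately show "x \<in> \<Union>Q" using B unfolding Q_def by blast
      qed
    qed
    show "{} \<notin> Q" using nc_nonempty[OF R] by (simp add: Q_def)
    show "B = B'" if "B \<in> Q" "B' \<in> Q" "x \<in> B" "x \<in> B'" for B B' x
      using that blocks unfolding Q_def by blast
    show "noncrossing Q"
      by (rule noncrossing_refine[OF ncR, of "\<lambda>B. B"]) (auto simp: Q_def)
  qed
  have "\<Union>{B\<in>P. j \<in> B} = C"
  proof (cases "j = 0")
    case True
    then have "P = {}" "C = {}" using P C0 by (auto simp: nc_def partition_on_empty)
    then show ?thesis by simp
  next
    case False
    then have "C \<in> P" "j \<in> C" using j0 by (auto simp: P_def)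
    then show ?thesis by (rule Union_block[OF P])
  qed
  moreover have "P - {C} = {B\<in>R. B \<subseteq> {1..j}}"
  proof -
    have "C \<notin> {B\<in>R. B \<subseteq> {1..j}}"
    proof
      assume C: "C \<in> {B\<in>R. B \<subseteq> {1..j}}"
      then have "C \<noteq> {}" using nc_nonempty[OF R] by auto
      then show False using C C_disj[of C] by blast
    qed
    then show ?thesis by (auto simp: P_def)
  qed
  ultimately have "attach n (j, P, Q) = R"
    unfolding attach_def prod.case Let_def using Rsplit by (simp add: B0_eq)
  then show ?thesis using that det jn P Q by blast
qed

section \<open>Generating function of noncrossing partitions\<close>

text \<open>The exponent is the rank in the lattice of noncrossing partitions; it is the statistic
  that corresponds to fixed points.\<close>

definition nc_sum :: "'a::comm_semiring_1 \<Rightarrow> nat \<Rightarrow> 'a" where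
  "nc_sum q n = (\<Sum>P\<in>nc {1..n}. q ^ (n - card P))"

lemma nc_sum_0: "nc_sum q 0 = 1"
proof -
  have "nc {1..0} = {{}}" by (auto simp: nc_def partition_on_empty noncrossing_def)
  then show ?thesis by (simp add: nc_sum_def)
qed

text \<open>The new element raises the rank by one unless it forms a block of its own, which happens
  exactly for \<open>j = 0\<close>; hence the factor \<open>q\<close> only for positive
  \<open>j\<close>.\<close>

lemma nc_sum_Suc:
  "nc_sum q (Suc n) = (\<Sum>j\<le>n. (if j = 0 then 1 else q * nc_sum q j) * nc_sum q (n - j))"
proof -
  let ?S = "SIGMA j:{..n}. nc {1..j} \<times> nc {j + 1..n}"
  have "nc_sum q (Suc n) = (\<Sum>x\<in>?S. q ^ (Suc n - card (attach n x)))"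
    unfolding nc_sum_def
  proof (rule sum.reindex_bij_witness[where i = "attach n" and j = "detach n"])
    fix R assume "R \<in> nc {1..Suc n}"
    then have R: "R \<in> nc {1..n + 1}" by simp
    obtain j P Q where *: "detach n R = (j, P, Q)" "j \<le> n" "P \<in> nc {1..j}" "Q \<in> nc {j + 1..n}"
      "attach n (j, P, Q) = R" by (rule nc_detach[OF R])
    show "attach n (detach n R) = R" using * by simp
    show "detach n R \<in> ?S" using * by simp
    show "q ^ (Suc n - card (attach n (detach n R))) = q ^ (Suc n - card R)" using * by simp
  next
    fix x assume "x \<in> ?S"
    then obtain j P Q where x: "x = (j, P, Q)" "j \<le> n" "P \<in> nc {1..j}" "Q \<in> nc {j + 1..n}"
      by blast
    show "detach n (attach n x) = x" "attach n x \<in> nc {1..Suc n}"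
      using detach_attach[OF x(2-4)] attach_in_nc[OF x(2-4)] x(1) by simp_all
  qed
  also have "\<dots> = (\<Sum>j\<le>n. \<Sum>P\<in>nc {1..j}. \<Sum>Q\<in>nc {j + 1..n}. q ^ (Suc n - card (attach n (j, P, Q))))"
    by (simp add: sum.Sigma sum.cartesian_product finite_nc)
  also have "\<dots> = (\<Sum>j\<le>n. (if j = 0 then 1 else q * nc_sum q j) * nc_sum q (n - j))"
  proof (rule sum.cong[OF refl])
    fix j assume "j \<in> {..n}"
    then have j: "j \<le> n" by simp
    have "(\<Sum>P\<in>nc {1..j}. \<Sum>Q\<in>nc {j + 1..n}. q ^ (Suc n - card (attach n (j, P, Q))))
        = (\<Sum>P\<in>nc {1..j}. \<Sum>Q\<in>nc {j + 1..n}.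
            ((if j = 0 then 1 else q) * q ^ (j - card P)) * q ^ (n - j - card Q))"
    proof (intro sum.cong refl)
      fix P Q assume P: "P \<in> nc {1..j}" and Q: "Q \<in> nc {j + 1..n}"
      have "card P \<le> j" "card Q \<le> n - j" using card_nc_le[OF _ P] card_nc_le[OF _ Q] by simp_all
      then have "Suc n - card (attach n (j, P, Q))
          = (if j = 0 then 0 else 1) + (j - card P) + (n - j - card Q)"
        using j unfolding card_attach[OF j P Q] by auto
      then show "q ^ (Suc n - card (attach n (j, P, Q)))
          = ((if j = 0 then 1 else q) * q ^ (j - card P)) * q ^ (n - j - card Q)"
        by (simp add: power_add)
    qed
    also have "\<dots> = ((if j = 0 then 1 else q) * nc_sum q j)
        * (\<Sum>Q\<in>nc {j + 1..n}. q ^ (n - j - card Q))"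
      unfolding nc_sum_def sum_distrib_left[of "if j = 0 then 1 else q"] sum_product ..
    also have "(\<Sum>Q\<in>nc {j + 1..n}. q ^ (n - j - card Q)) = nc_sum q (n - j)"
      using sum_nc_translate[of "\<lambda>c. q ^ (n - j - c)" j "n - j"] j by (simp add: nc_sum_def)
    also have "(if j = 0 then 1 else q) * nc_sum q j = (if j = 0 then 1 else q * nc_sum q j)"
      by (simp add: nc_sum_0)
    finally show "(\<Sum>P\<in>nc {1..j}. \<Sum>Q\<in>nc {j + 1..n}. q ^ (Suc n - card (attach n (j, P, Q))))
        = (if j = 0 then 1 else q * nc_sum q j) * nc_sum q (n - j)" .
  qed
  finally show ?thesis .
qed

lemma nc_sum_equation:
  fixes q :: "'a::comm_ring_1"
  defines "F \<equiv> Abs_fps (nc_sum q)"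
  shows "F = 1 + fps_X * F * (1 + fps_const q * (F - 1))"
proof -
  let ?h = "\<lambda>j. if j = 0 then 1 else q * nc_sum q j"
  have "F = 1 + fps_X * (Abs_fps ?h * F)"
    using fps_eq_if_convolution[of "nc_sum q" ?h "nc_sum q", OF nc_sum_Suc]
    by (simp only: F_def nc_sum_0 fps_const_1_eq_1)
  also have "Abs_fps ?h = 1 + fps_const q * (F - 1)"
    by (simp add: F_def fps_eq_iff nc_sum_0)
  finally show ?thesis by (simp only: mult_ac)
qed

section \<open>The two Narayana counts and the closed form\<close>

lemma narayana_eq_card_dumont2:
  assumes "n \<ge> 1"
  shows "of_nat (card {\<pi>\<in>dumont2_avoiding n [3,1,4,2]. num_fixed_points (2*n) \<pi> = k}) = narayana n k"
  by (rule narayana_card[OF fix_sum_equation _ _ assms])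
    (use finite_dumont2_3142 in \<open>simp_all only: fps_nth_Abs_fps fix_sum_def dumont2_3142_def\<close>)

text \<open>Since \<open>card P \<le> n\<close>, the equation between integers amounts to
  \<open>n - card P = k\<close>, also for \<open>k > n\<close>, where both sets are empty.\<close>

lemma narayana_eq_card_noncrossing:
  assumes "n \<ge> 1"
  shows "of_nat (card {P\<in>noncrossing_partitions n. int (card P) = int n - int k}) = narayana n k"
proof -
  have "{P\<in>noncrossing_partitions n. int (card P) = int n - int k} = {P\<in>nc {1..n}. n - card P = k}"
  proof (intro Collect_cong conj_cong)
    show "P \<in> noncrossing_partitions n \<longleftrightarrow> P \<in> nc {1..n}" for P
      by (simp add: noncrossing_partitions_def nc_def)
    show "int (card P) = int n - int k \<longleftrightarrow> n - card P = k" if "P \<in> nc {1..n}" for P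
      using card_nc_le[OF _ that] by auto
  qed
  moreover have "of_nat (card {P\<in>nc {1..n}. n - card P = k}) = narayana n k"
    by (rule narayana_card[OF nc_sum_equation _ _ assms]) (simp_all add: nc_sum_def finite_nc)
  ultimately show ?thesis by simp
qed

theorem corollary3p3:
  shows "Abs_fps (\<lambda>n. \<Sum>\<pi>\<in>dumont2_avoiding n [3,1,4,2]. q_var ^ num_fixed_points (2*n) \<pi>) =
           (1 + fps_X * fps_const (q_var - 1)
              - fps_sqrt (1 - 2 * fps_X * fps_const (q_var + 1)
                            + fps_X ^ 2 * fps_const (q_var - 1) ^ 2))
           / (2 * fps_X * fps_const q_var)
       \<and> (\<forall>n\<ge>1. \<forall>k.
            of_nat (card {\<pi> \<in> dumont2_avoiding n [3,1,4,2]. num_fixed_points (2*n) \<pi> = k})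
              = narayana n k
          \<and> narayana n k
              = of_nat (card {P \<in> noncrossing_partitions n. int (card P) = int n - int k}))"
proof -
  have "Abs_fps (\<lambda>n. \<Sum>\<pi>\<in>dumont2_avoiding n [3,1,4,2]. q_var ^ num_fixed_points (2*n) \<pi>)
      = Abs_fps (fix_sum q_var)"
    unfolding fix_sum_def[abs_def] dumont2_3142_def ..
  also note narayana_equation_closed_form[OF fix_sum_equation q_var_neq_0]
  finally show ?thesis
    by (intro conjI allI impI narayana_eq_card_dumont2 narayana_eq_card_noncrossing[symmetric])
qed

end
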